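(* Let $$k(T) = 63(3T^2 - 3T + 1)(T^2 + T + 1)(T^2 - 3T + 3) \in \mathbb{Q}[T].$$ Then the elliptic curve $E_{k(T)}$ over the rational function field $\mathbb{Q}(T)$ given by $$E_{k(T)}:\ X^3 + Y^3 = k(T)$$ has Mordell–Weil rank exactly $2$ over $\mathbb{Q}(T)$.
   Context: The projective closure of the plane cubic $X^3+Y^3=k(T)$ over $\mathbb{Q}(T)$ is an elliptic curve (a cubic twist of $X^3+Y^3=1$, with $j$-invariant $0$). The rank is that of the finitely generated abelian group $E_{k(T)}(\mathbb{Q}(T))$. *)

theory Defs
  imports "HOL-Computational_Algebra.Polynomial" "HOL-Computational_Algebra.Fraction_Field"
begin

text \<open>Rational points of the projective cubic X^3 + Y^3 = k Z^3 over a field.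
  A point is either None, standing for the point at infinity O = (1 : -1 : 0)
  (the only point at infinity rational over a field in which -1 has no cube root
  other than -1, e.g. Q(T)), or Some (x, y) with x^3 + y^3 = k.\<close>

type_synonym 'a cpt = "('a \<times> 'a) option"

definition on_cubic :: "'a::field \<Rightarrow> 'a cpt \<Rightarrow> bool" where
  "on_cubic k P = (case P of None \<Rightarrow> True | Some (x, y) \<Rightarrow> x ^ 3 + y ^ 3 = k)"

text \<open>Reflection (x,y) -> (y,x): the third intersection of the line through O and P.\<close>
definition cswap :: "'a cpt \<Rightarrow> 'a cpt" where
  "cswap P = (case P of None \<Rightarrow> None | Some (x, y) \<Rightarrow> Some (y, x))"

text \<open>Third intersection point of the line through P and Q (tangent if P = Q)
  with the cubic (chord-tangent construction). O is a flex, so O*O = O.\<close>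
definition third :: "'a::field \<Rightarrow> 'a cpt \<Rightarrow> 'a cpt \<Rightarrow> 'a cpt" where
  "third k P Q =
    (case P of None \<Rightarrow> cswap Q
     | Some (x1, y1) \<Rightarrow>
       (case Q of None \<Rightarrow> cswap P
        | Some (x2, y2) \<Rightarrow>
          (if x1 = x2 \<and> (y1 \<noteq> y2 \<or> y1 = 0) then Some (x1, - y1 - y2)
           else
             (let m = (if x1 \<noteq> x2 then (y2 - y1) / (x2 - x1) else - (x1 ^ 2) / (y1 ^ 2))
              in if 1 + m ^ 3 = 0 then None
                 else (let x3 = - 3 * m ^ 2 * (y1 - m * x1) / (1 + m ^ 3) - x1 - x2
                       in Some (x3, y1 + m * (x3 - x1)))))))"

text \<open>Group law with neutral element O: P + Q = O * (P * Q).\<close>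
definition cadd :: "'a::field \<Rightarrow> 'a cpt \<Rightarrow> 'a cpt \<Rightarrow> 'a cpt" where
  "cadd k P Q = cswap (third k P Q)"

definition csmul :: "'a::field \<Rightarrow> int \<Rightarrow> 'a cpt \<Rightarrow> 'a cpt" where
  "csmul k n P = (if n \<ge> 0 then (cadd k P ^^ nat n) None else cswap ((cadd k P ^^ nat (- n)) None))"

definition cindep :: "'a::field \<Rightarrow> 'a cpt list \<Rightarrow> bool" where
  "cindep k ps \<longleftrightarrow> (\<forall>P\<in>set ps. on_cubic k P) \<and>
     (\<forall>cs :: int list. length cs = length ps \<longrightarrow>
        foldr (cadd k) (map2 (csmul k) cs ps) None = None \<longrightarrow> (\<forall>c\<in>set cs. c = 0))"

definition mw_rank_eq :: "'a::field \<Rightarrow> nat \<Rightarrow> bool" where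
  "mw_rank_eq k r \<longleftrightarrow> (\<exists>ps. length ps = r \<and> cindep k ps) \<and> (\<forall>ps. cindep k ps \<longrightarrow> length ps \<le> r)"

definition kT :: "rat poly fract" where
  "kT = Fract (63 * [:1, -3, 3:] * [:1, 1, 1:] * [:3, -3, 1:]) 1"

end

theory Submission
  imports Defs
    "HOL-Computational_Algebra.Field_as_Ring"
    "HOL-Computational_Algebra.Nth_Powers"
    "HOL-Computational_Algebra.Polynomial_Factorial"
    "HOL-Computational_Algebra.Squarefree"
begin

text \<open>
  Write w for a primitive cube root of unity and K for Q(w). The proof bounds E(Q(T))/3E(Q(T)) by a
  descent through multiplication by sqrt(-3) and then removes any third independent point by a
  descent on heights.

  All six roots of k lie in K. At such a root r the curve degenerates to the three lines
  x = -w^i y, and the line hit by a point P defines a homomorphism rho r from E(Q(T)) to the cube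
  roots of unity. For roots r1, r2, r3 of the three quadratic factors, a norm computation in K shows
  that rho r1 P = rho r2 P = 1 forces rho r3 P = 1. If all three are 1, then w x + w^2 y is a rational
  constant times a cube in K[T], which makes P the image of a point on the 3-isogenous curve
  A B (A + B) = k; comparing the classes of A, B, A + B modulo cubes shows that P lies in 3E.
  Hence 3E has index at most 9.

  For coprime coordinates x, y the number max (deg x) (deg y) is the degree of a map from
  the curve s^3 = k(T) to the Fermat cubic, hence an exact quadratic form vanishing only at O.
  Three independent points admit a combination with coefficients in {-1,0,1} equal to 3S, and
  replacing the highest point involved by S keeps independence but lowers the total height.

  Two independent points come from (5u - 3, 4u + 6), u = T^2 - T, and its transform under T -> 1/T.
\<close>

section \<open>The group law\<close>

text \<open>The count behind the descent is tight: 27 combinations of three points against 9 values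
  of (\<open>rho r1\<close>, \<open>rho r2\<close>). All three maps \<open>rho r\<close> together
  would only bound the rank by 3, and the missing factor is due to the constant 63. Over the complex
  numbers 63 could be scaled away; over Q its 7-adic valuation 1 is the obstruction used in
  \<open>no_mixed_distribution\<close>, and a factor of norm 7 in K is the one used in
  \<open>no_rho_om\<close>. The height has to be quadratic exactly, not up to a bounded error:
  tripling multiplies it by 9, while a sum of three points of height at most h has height at most
  9h, with equality only if they coincide. This strictness drives the descent. The same height shows
  that there is no 3-torsion, which the lower bound uses.\<close>

text \<open>
  With (A, B, C) = (-z, x, y) this is the rotated addition law of Bernstein, Chuengsatiansup, Kohel and
  Lange on the twisted Hessian curve k A^3 + B^3 + C^3 = 0. It has no exceptional pairs
  of points as long as k is not a cube, so the group axioms become polynomial identities without case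
  distinctions.
\<close>

definition addx :: "'a::idom \<Rightarrow> 'a \<Rightarrow> 'a \<Rightarrow> 'a \<Rightarrow> 'a \<Rightarrow> 'a \<Rightarrow> 'a \<Rightarrow> 'a" where
  "addx k x1 y1 z1 x2 y2 z2 = x1 * y1 * x2\<^sup>2 + k * z1\<^sup>2 * y2 * z2"

definition addy :: "'a::idom \<Rightarrow> 'a \<Rightarrow> 'a \<Rightarrow> 'a \<Rightarrow> 'a \<Rightarrow> 'a \<Rightarrow> 'a \<Rightarrow> 'a" where
  "addy k x1 y1 z1 x2 y2 z2 = - (k * x1 * z1 * z2\<^sup>2) - y1\<^sup>2 * x2 * y2"

definition addz :: "'a::idom \<Rightarrow> 'a \<Rightarrow> 'a \<Rightarrow> 'a \<Rightarrow> 'a \<Rightarrow> 'a \<Rightarrow> 'a \<Rightarrow> 'a" where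
  "addz k x1 y1 z1 x2 y2 z2 = y1 * z1 * y2\<^sup>2 - x1\<^sup>2 * x2 * z2"

lemmas add_defs = addx_def addy_def addz_def

lemma add_on_curve:
  fixes k :: "'a::idom"
  assumes "x1 ^ 3 + y1 ^ 3 = k * z1 ^ 3" "x2 ^ 3 + y2 ^ 3 = k * z2 ^ 3"
  shows "addx k x1 y1 z1 x2 y2 z2 ^ 3 + addy k x1 y1 z1 x2 y2 z2 ^ 3
    = k * addz k x1 y1 z1 x2 y2 z2 ^ 3"
  using assms unfolding add_defs by algebra

lemma add_commute_cross:
  fixes k :: "'a::idom"
  assumes "x1 ^ 3 + y1 ^ 3 = k * z1 ^ 3" "x2 ^ 3 + y2 ^ 3 = k * z2 ^ 3"
  defines "X \<equiv> addx k x1 y1 z1 x2 y2 z2" and "X' \<equiv> addx k x2 y2 z2 x1 y1 z1"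
    and "Y \<equiv> addy k x1 y1 z1 x2 y2 z2" and "Y' \<equiv> addy k x2 y2 z2 x1 y1 z1"
    and "Z \<equiv> addz k x1 y1 z1 x2 y2 z2" and "Z' \<equiv> addz k x2 y2 z2 x1 y1 z1"
  shows "X * Y' = X' * Y" "X * Z' = X' * Z" "Y * Z' = Y' * Z"
  using assms(1,2) unfolding assms(3-) add_defs by algebra+

lemma add_assoc_cross:
  fixes k :: "'a::idom"
  assumes "x1 ^ 3 + y1 ^ 3 = k * z1 ^ 3" "x2 ^ 3 + y2 ^ 3 = k * z2 ^ 3" "x3 ^ 3 + y3 ^ 3 = k * z3 ^ 3"
  defines "X12 \<equiv> addx k x1 y1 z1 x2 y2 z2" and "Y12 \<equiv> addy k x1 y1 z1 x2 y2 z2"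
    and "Z12 \<equiv> addz k x1 y1 z1 x2 y2 z2"
    and "X23 \<equiv> addx k x2 y2 z2 x3 y3 z3" and "Y23 \<equiv> addy k x2 y2 z2 x3 y3 z3"
    and "Z23 \<equiv> addz k x2 y2 z2 x3 y3 z3"
  defines "X \<equiv> addx k X12 Y12 Z12 x3 y3 z3" and "X' \<equiv> addx k x1 y1 z1 X23 Y23 Z23"
    and "Y \<equiv> addy k X12 Y12 Z12 x3 y3 z3" and "Y' \<equiv> addy k x1 y1 z1 X23 Y23 Z23"
    and "Z \<equiv> addz k X12 Y12 Z12 x3 y3 z3" and "Z' \<equiv> addz k x1 y1 z1 X23 Y23 Z23"
  shows "X * Y' = X' * Y" "X * Z' = X' * Z" "Y * Z' = Y' * Z"
  using assms(1-3) unfolding assms(4-) add_defs by algebra+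

text \<open>The product in the proof is twice the difference of the cubes, and its second factor is
  a sum of squares. The order on \<open>rat poly\<close> and its fractions (sign of the leading
  coefficient) serves to make cube roots unique, so that \<open>None\<close> is the only point at
  infinity.\<close>

lemma cube_eq_iff:
  fixes x y :: "'a::linordered_idom"
  shows "x ^ 3 = y ^ 3 \<longleftrightarrow> x = y"
proof
  assume "x ^ 3 = y ^ 3"
  hence "(x - y) * (x\<^sup>2 + (x + y)\<^sup>2 + y\<^sup>2) = 0" by algebra
  thus "x = y" by (auto simp: add_nonneg_eq_0_iff)
qed simp

lemma cubic_proj_zero:
  fixes k :: "'a::linordered_idom"
  assumes k: "\<forall>m n. k * m ^ 3 = n ^ 3 \<longrightarrow> m = 0" and "x ^ 3 + y ^ 3 = k * z ^ 3"
  shows "x = 0 \<Longrightarrow> y = 0" "y = 0 \<Longrightarrow> x = 0" "x = 0 \<Longrightarrow> z = 0" "y = 0 \<Longrightarrow> z = 0" "z = 0 \<Longrightarrow> y = - x"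
proof -
  show z: "x = 0 \<Longrightarrow> z = 0" "y = 0 \<Longrightarrow> z = 0"
    using assms(2) k[rule_format, of z y] k[rule_format, of z x] by auto
  show "x = 0 \<Longrightarrow> y = 0" "y = 0 \<Longrightarrow> x = 0"
    using z assms(2) by auto
  show "z = 0 \<Longrightarrow> y = - x"
    using assms(2) cube_eq_iff[of y "- x"] by (auto simp: eq_neg_iff_add_eq_0 add.commute)
qed

text \<open>If all three forms vanished, eliminating between them would give
  \<open>k * (x1 * z2) ^ 3 = (- (y1 * y2)) ^ 3\<close>, making \<open>k\<close> a cube. By
  \<open>cubic_proj_zero\<close> a vanishing first or second coordinate kills all three, so the
  conclusion concerns these two only.\<close>

lemma add_nondegenerate:
  fixes k :: "'a::linordered_idom"
  assumes k: "\<forall>m n. k * m ^ 3 = n ^ 3 \<longrightarrow> m = 0"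
    and c: "x1 ^ 3 + y1 ^ 3 = k * z1 ^ 3" "x2 ^ 3 + y2 ^ 3 = k * z2 ^ 3"
    and nz: "x1 \<noteq> 0" "x2 \<noteq> 0"
  shows "addx k x1 y1 z1 x2 y2 z2 \<noteq> 0 \<and> addy k x1 y1 z1 x2 y2 z2 \<noteq> 0"
proof -
  note z = cubic_proj_zero[OF k]
  have nz': "y1 \<noteq> 0" "y2 \<noteq> 0" using nz z(2)[OF c(1)] z(2)[OF c(2)] by auto
  have "\<not> (addx k x1 y1 z1 x2 y2 z2 = 0 \<and> addy k x1 y1 z1 x2 y2 z2 = 0 \<and> addz k x1 y1 z1 x2 y2 z2 = 0)"
  proof
    assume A: "addx k x1 y1 z1 x2 y2 z2 = 0 \<and> addy k x1 y1 z1 x2 y2 z2 = 0 \<and> addz k x1 y1 z1 x2 y2 z2 = 0"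
    show False
    proof (cases "z1 = 0 \<or> z2 = 0")
      case True
      then show False using A nz nz' by (auto simp: add_defs)
    next
      case False
      have X: "x1 * y1 * x2\<^sup>2 = - (k * z1\<^sup>2 * y2 * z2)" and Z: "y1 * z1 * y2\<^sup>2 = x1\<^sup>2 * x2 * z2"
        using A by (simp_all add: add_defs eq_neg_iff_add_eq_0)
      have "z1\<^sup>2 * y2 * (k * (x1 * z2) ^ 3 - (- (y1 * y2)) ^ 3)
          = x1 ^ 3 * z2\<^sup>2 * (k * z1\<^sup>2 * y2 * z2) + y1 * (y1 * z1 * y2\<^sup>2)\<^sup>2" by algebra
      also have "k * z1\<^sup>2 * y2 * z2 = - (x1 * y1 * x2\<^sup>2)" using X by simp
      also have "x1 ^ 3 * z2\<^sup>2 * - (x1 * y1 * x2\<^sup>2) + y1 * (y1 * z1 * y2\<^sup>2)\<^sup>2 = 0"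
        unfolding Z by algebra
      finally have "k * (x1 * z2) ^ 3 = (- (y1 * y2)) ^ 3" using nz' False by simp
      from k[rule_format, OF this] show False using nz False by simp
    qed
  qed
  moreover have "addx k x1 y1 z1 x2 y2 z2 = 0 \<longleftrightarrow> addy k x1 y1 z1 x2 y2 z2 = 0"
    "addx k x1 y1 z1 x2 y2 z2 = 0 \<Longrightarrow> addz k x1 y1 z1 x2 y2 z2 = 0"
    using z[OF add_on_curve[OF c]] by blast+
  ultimately show ?thesis by blast
qed

section \<open>Homogeneous coordinates and agreement with the chord-tangent law\<close>

definition proj :: "'a::field cpt \<Rightarrow> 'a \<Rightarrow> 'a \<Rightarrow> 'a \<Rightarrow> bool" where
  "proj P x y z = (case P of None \<Rightarrow> z = 0 \<and> y = - x \<and> x \<noteq> 0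
     | Some (u, v) \<Rightarrow> z \<noteq> 0 \<and> x = u * z \<and> y = v * z)"

lemma proj_curve:
  assumes "on_cubic k P" "proj P x y z"
  shows "x ^ 3 + y ^ 3 = k * z ^ 3"
  using assms by (auto simp: on_cubic_def proj_def power_mult_distrib simp flip: distrib_right split: option.splits)

lemma proj_exists: "\<exists>x y z. proj P x y z"
proof (cases P)
  case None
  hence "proj P 1 (-1) 0" by (simp add: proj_def)
  thus ?thesis by blast
next
  case (Some p)
  hence "proj P (fst p) (snd p) 1" by (simp add: proj_def case_prod_unfold)
  thus ?thesis by blast
qed

lemma proj_imp_on_cubic:
  assumes "proj P x y z" "x ^ 3 + y ^ 3 = k * z ^ 3"
  shows "on_cubic k P"
  using assms by (auto simp: on_cubic_def proj_def power_mult_distrib simp flip: distrib_right split: option.splits)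

lemma proj_unique:
  assumes "proj P x y z" "proj Q x' y' z'" "x * y' = x' * y" "x * z' = x' * z" "y * z' = y' * z"
  shows "P = Q"
  using assms by (auto simp: proj_def split: option.splits)

lemma proj_scale:
  assumes "c \<noteq> 0"
  shows "proj P (c * x) (c * y) (c * z) \<longleftrightarrow> proj P x y z"
  using assms by (auto simp: proj_def minus_mult_right simp del: mult_minus_right split: option.splits)

lemma proj_cswap: "proj P x y z \<Longrightarrow> proj (cswap P) y x z"
  by (auto simp: proj_def cswap_def split: option.splits)

locale cubic =
  fixes k :: "'a::linordered_field"
  assumes k: "\<forall>m n. k * m ^ 3 = n ^ 3 \<longrightarrow> m = 0"
begin

lemmas proj_zero = cubic_proj_zero[OF k]

lemma proj_ex:
  assumes "x ^ 3 + y ^ 3 = k * z ^ 3" "x \<noteq> 0"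
  shows "\<exists>P. on_cubic k P \<and> proj P x y z"
proof (cases "z = 0")
  case True
  with assms proj_zero(5)[OF assms(1)] show ?thesis
    by (intro exI[of _ None]) (auto simp: proj_def on_cubic_def)
next
  case False
  hence "proj (Some (x / z, y / z)) x y z" by (simp add: proj_def)
  thus ?thesis using proj_imp_on_cubic assms by blast
qed

lemma k_nz: "k \<noteq> 0"
  using k[rule_format, of 1 0] by auto

lemma proj_nz: "on_cubic k P \<Longrightarrow> proj P x y z \<Longrightarrow> x \<noteq> 0 \<and> y \<noteq> 0"
proof -
  assume P: "on_cubic k P" "proj P x y z"
  from P(2) have "x \<noteq> 0 \<or> z \<noteq> 0" by (auto simp: proj_def split: option.splits)
  with proj_zero[OF proj_curve[OF P]] show ?thesis by metis
qed

text \<open>The bridge from the chord-tangent definition to the addition law. \<open>cadd\<close>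
  swaps the output of \<open>third\<close>, so \<open>x3\<close> is compared with \<open>Y\<close>
  and the other coordinate with \<open>X\<close>.\<close>

lemma cadd_affine:
  assumes c1: "x1 ^ 3 + y1 ^ 3 = k" and c2: "x2 ^ 3 + y2 ^ 3 = k"
  defines "X \<equiv> addx k x1 y1 1 x2 y2 1" and "Y \<equiv> addy k x1 y1 1 x2 y2 1" and "Z \<equiv> addz k x1 y1 1 x2 y2 1"
  shows "proj (cadd k (Some (x1, y1)) (Some (x2, y2))) X Y Z"
proof -
  have nz: "x1 \<noteq> 0" "x2 \<noteq> 0" "y1 \<noteq> 0" "y2 \<noteq> 0"
    using proj_zero[of x1 y1 1] proj_zero[of x2 y2 1] c1 c2 by auto
  have XY: "X \<noteq> 0" "Y \<noteq> 0"
    using add_nondegenerate[OF k, of x1 y1 1 x2 y2 1] c1 c2 nz unfolding X_def Y_def by auto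
  have C: "X ^ 3 + Y ^ 3 = k * Z ^ 3"
    unfolding X_def Y_def Z_def by (rule add_on_curve) (use c1 c2 in auto)
  have affine: "proj (Some (y, x)) X Y Z" if "y * Z = X" "x * Z = Y" for x y
    using that XY by (auto simp: proj_def)
  define m where "m = (if x1 \<noteq> x2 then (y2 - y1) / (x2 - x1) else - (x1 ^ 2) / (y1 ^ 2))"
  define x3 where "x3 = - 3 * m ^ 2 * (y1 - m * x1) / (1 + m ^ 3) - x1 - x2"
  \<comment> \<open>Together with \<open>y1\<close> being nonzero, this rules out the vertical
    branch of \<open>third\<close>: equal abscissae always mean the tangent case.\<close>
  have y: "y1 = y2" if "x1 = x2"
    using c1 c2 that cube_eq_iff[of y1 y2] by auto
  have m1: "m = - 1" if "1 + m ^ 3 = 0"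
    using cube_eq_iff[of m "- 1"] that by (simp add: add_eq_0_iff)
  have sum: "x1 + y1 \<noteq> 0"
  proof
    assume "x1 + y1 = 0"
    hence "y1 = - x1" by algebra
    with c1 k_nz show False by simp
  qed
  show ?thesis
  proof (cases "1 + m ^ 3 = 0")
    case True
    \<comment> \<open>Slope -1 is the direction of O, so the third intersection is O and the two
      points are mirror images of each other.\<close>
    have "y1 = x2 \<and> y2 = x1"
    proof (cases "x1 = x2")
      case True
      have "x1\<^sup>2 = y1\<^sup>2" using m1[OF \<open>1 + m ^ 3 = 0\<close>] True nz by (auto simp: m_def field_simps)
      hence "x1 = y1" using sum by (auto simp: power2_eq_iff)
      thus ?thesis using True y by auto
    next
      case False
      have l: "x1 + y1 = x2 + y2" using m1[OF True] False by (auto simp: m_def field_simps)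
      hence y2: "y2 = x1 + y1 - x2" by simp
      have "3 * (x1 + y1) * (x1 - x2) * (y1 - x2) = (x2 ^ 3 + y2 ^ 3) - (x1 ^ 3 + y1 ^ 3)"
        unfolding y2 by algebra
      also have "\<dots> = 0" using c1 c2 by simp
      finally have "y1 = x2" using sum False by auto
      thus ?thesis using l by auto
    qed
    hence "Z = 0" "third k (Some (x1, y1)) (Some (x2, y2)) = None"
      using True y nz unfolding third_def m_def Z_def by (auto simp: add_defs Let_def power2_eq_square)
    thus ?thesis using proj_zero(5)[OF C] XY by (auto simp: cadd_def cswap_def proj_def)
  next
    case False
    have "third k (Some (x1, y1)) (Some (x2, y2)) = Some (x3, y1 + m * (x3 - x1))"
      using False y nz unfolding third_def m_def x3_def by (auto simp: Let_def)
    moreover have "(y1 + m * (x3 - x1)) * Z = X \<and> x3 * Z = Y"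
    proof (cases "x1 = x2")
      case True
      have m: "m * y1\<^sup>2 = - (x1\<^sup>2)" using True nz by (simp add: m_def)
      have x3: "x3 * (1 + m ^ 3) = - 3 * m ^ 2 * (y1 - m * x1) - (x1 + x2) * (1 + m ^ 3)"
        using False by (simp add: x3_def field_simps)
      have Zt: "Z = y1 ^ 3 - x1 ^ 3" using True y by (simp add: Z_def add_defs power2_eq_square power3_eq_cube)
      have Xt: "X = y1 * (2 * x1 ^ 3 + y1 ^ 3)"
        using True y c1 by (simp add: X_def add_defs power2_eq_square power3_eq_cube algebra_simps flip: c1)
      have Yt: "Y = - (x1 * (x1 ^ 3 + 2 * y1 ^ 3))"
        using True y c1 by (simp add: Y_def add_defs power2_eq_square power3_eq_cube algebra_simps flip: c1)
      \<comment> \<open>The factor \<open>y1 ^ 6\<close> clears the denominator of \<open>m\<close>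
        up to its third power, so all comparisons become polynomial in \<open>x1\<close> and
        \<open>y1\<close>.\<close>
      have "m ^ 2 * y1 ^ 4 = (m * y1\<^sup>2)\<^sup>2" "m ^ 3 * y1 ^ 6 = (m * y1\<^sup>2) ^ 3"
        by (simp_all add: power_mult_distrib flip: power_mult)
      hence m23: "m ^ 2 * y1 ^ 4 = x1 ^ 4" "m ^ 3 * y1 ^ 6 = - (x1 ^ 6)"
        unfolding m by (simp_all flip: power_mult)
      have M: "(1 + m ^ 3) * y1 ^ 6 = y1 ^ 6 - x1 ^ 6"
        using m23 by (simp add: algebra_simps)
      have "x3 * (1 + m ^ 3) * y1 ^ 6 = - 3 * (m ^ 2 * y1 ^ 4) * y1 ^ 3 + 3 * (m ^ 3 * y1 ^ 6) * x1
          - 2 * x1 * ((1 + m ^ 3) * y1 ^ 6)"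
        unfolding x3 True[symmetric] by algebra
      hence N: "x3 * (1 + m ^ 3) * y1 ^ 6 = - 3 * x1 ^ 4 * y1 ^ 3 - 3 * x1 ^ 7 - 2 * x1 * (y1 ^ 6 - x1 ^ 6)"
        unfolding m23 M by algebra
      have "(1 + m ^ 3) * y1 ^ 6 * (x3 * Z - Y) = (x3 * (1 + m ^ 3) * y1 ^ 6) * Z - ((1 + m ^ 3) * y1 ^ 6) * Y"
        by (simp add: algebra_simps)
      also have "\<dots> = 0" unfolding M N Zt Yt by algebra
      finally have 1: "(1 + m ^ 3) * y1 ^ 6 * (x3 * Z - Y) = 0" .
      have "m * (x3 * (1 + m ^ 3) * y1 ^ 6 - x1 * ((1 + m ^ 3) * y1 ^ 6)) = (m * y1\<^sup>2) * (- 3 * x1 * y1 * (x1 ^ 3 + y1 ^ 3))"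
        unfolding M N by algebra
      hence mN: "m * (x3 * (1 + m ^ 3) * y1 ^ 6 - x1 * ((1 + m ^ 3) * y1 ^ 6)) = 3 * x1 ^ 3 * y1 * (x1 ^ 3 + y1 ^ 3)"
        unfolding m by algebra
      have "(1 + m ^ 3) * y1 ^ 6 * ((y1 + m * (x3 - x1)) * Z - X)
          = (((1 + m ^ 3) * y1 ^ 6) * y1 + m * (x3 * (1 + m ^ 3) * y1 ^ 6 - x1 * ((1 + m ^ 3) * y1 ^ 6))) * Z
            - ((1 + m ^ 3) * y1 ^ 6) * X"
        by (simp add: algebra_simps)
      also have "\<dots> = 0" unfolding mN unfolding M Zt Xt by algebra
      finally have "(1 + m ^ 3) * y1 ^ 6 * ((y1 + m * (x3 - x1)) * Z - X) = 0" .
      with 1 show ?thesis using False nz by auto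
    next
      case ne: False
      define d where "d = x2 - x1"
      have x2: "x2 = x1 + d" and y2: "y2 = y1 + m * d" and d: "d \<noteq> 0" using ne by (auto simp: m_def d_def)
      have x3: "x3 * (1 + m ^ 3) = - 3 * m ^ 2 * (y1 - m * x1) - (x1 + x2) * (1 + m ^ 3)"
        using False by (simp add: x3_def field_simps)
      have kk: "k = x1 ^ 3 + y1 ^ 3" using c1 by simp
      \<comment> \<open>The condition that the second point lies on the curve, from which the
        trivial factor \<open>d\<close> is then removed. Both comparisons below are explicit
        multiples of what is left.\<close>
      have "d * (3 * x1\<^sup>2 + 3 * x1 * d + d\<^sup>2 + m * (3 * y1\<^sup>2 + 3 * y1 * m * d + m\<^sup>2 * d\<^sup>2)) = 0"
        using c2 unfolding x2 y2 kk by algebra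
      hence G: "3 * x1\<^sup>2 + 3 * x1 * d + d\<^sup>2 + m * (3 * y1\<^sup>2 + 3 * y1 * m * d + m\<^sup>2 * d\<^sup>2) = 0"
        using d by simp
      have Zt: "Z = y1 * y2\<^sup>2 - x1\<^sup>2 * x2" and Xt: "X = x1 * y1 * x2\<^sup>2 + k * y2"
        and Yt: "Y = - (k * x1) - y1\<^sup>2 * x2 * y2"
        by (simp_all add: X_def Y_def Z_def add_defs)
      have "(1 + m ^ 3) * (x3 * Z - Y) = (x3 * (1 + m ^ 3)) * Z - (1 + m ^ 3) * Y"
        by (simp add: algebra_simps)
      also have "\<dots> = (x1\<^sup>2 + x1 * y1 * m\<^sup>2 - y1\<^sup>2 * m - y1 * m\<^sup>2 * d) * (3 * x1\<^sup>2 + 3 * x1 * d + d\<^sup>2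
          + m * (3 * y1\<^sup>2 + 3 * y1 * m * d + m\<^sup>2 * d\<^sup>2))"
        unfolding x3 Yt Zt kk x2 y2 by algebra
      also have "\<dots> = 0" unfolding G by simp
      finally have 1: "(1 + m ^ 3) * (x3 * Z - Y) = 0" .
      have "(1 + m ^ 3) * ((y1 + m * (x3 - x1)) * Z - X)
          = ((1 + m ^ 3) * y1 + m * (x3 * (1 + m ^ 3) - x1 * (1 + m ^ 3))) * Z - (1 + m ^ 3) * X"
        by (simp add: algebra_simps)
      also have "\<dots> = (x1\<^sup>2 * m - x1 * y1 - y1\<^sup>2 * m\<^sup>2 - y1 * m ^ 3 * d) * (3 * x1\<^sup>2 + 3 * x1 * d + d\<^sup>2
          + m * (3 * y1\<^sup>2 + 3 * y1 * m * d + m\<^sup>2 * d\<^sup>2))"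
        unfolding x3 Xt Zt kk x2 y2 by algebra
      also have "\<dots> = 0" unfolding G by simp
      finally have "(1 + m ^ 3) * ((y1 + m * (x3 - x1)) * Z - X) = 0" .
      with 1 show ?thesis using False by auto
    qed
    ultimately show ?thesis using affine by (simp add: cadd_def cswap_def)
  qed
qed

lemma proj_cadd:
  assumes "on_cubic k P" "on_cubic k Q" "proj P x1 y1 z1" "proj Q x2 y2 z2"
  shows "proj (cadd k P Q) (addx k x1 y1 z1 x2 y2 z2) (addy k x1 y1 z1 x2 y2 z2) (addz k x1 y1 z1 x2 y2 z2)"
proof -
  have n: "x1 \<noteq> 0" "y1 \<noteq> 0" "x2 \<noteq> 0" "y2 \<noteq> 0" using proj_nz assms by blast+
  show ?thesis
  proof (cases P)
    case None
    hence z1: "z1 = 0" "y1 = - x1" "cadd k P Q = Q"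
      using assms(3) by (auto simp: proj_def cadd_def third_def cswap_def split: option.splits)
    have "proj Q ((- (x1\<^sup>2 * x2)) * x2) ((- (x1\<^sup>2 * x2)) * y2) ((- (x1\<^sup>2 * x2)) * z2)"
      using assms(4) n by (subst proj_scale) auto
    thus ?thesis by (simp add: z1 add_defs power2_eq_square algebra_simps)
  next
    case P: (Some p)
    show ?thesis
    proof (cases Q)
      case None
      hence z2: "z2 = 0" "y2 = - x2" "cadd k P Q = P"
        using assms(4) P by (cases p; auto simp: proj_def cadd_def third_def cswap_def split: option.splits)+
      have "proj P ((y1 * x2\<^sup>2) * x1) ((y1 * x2\<^sup>2) * y1) ((y1 * x2\<^sup>2) * z1)"
        using assms(3) n by (subst proj_scale) auto
      thus ?thesis by (simp add: z2 add_defs power2_eq_square algebra_simps)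
    next
      case Q: (Some q)
      obtain u1 v1 u2 v2 where p: "P = Some (u1, v1)" "Q = Some (u2, v2)"
        using P Q by (cases p; cases q) auto
      have e: "x1 = u1 * z1" "y1 = v1 * z1" "z1 \<noteq> 0" "x2 = u2 * z2" "y2 = v2 * z2" "z2 \<noteq> 0"
        using assms(3,4) p by (auto simp: proj_def)
      have "proj (cadd k P Q) ((z1\<^sup>2 * z2\<^sup>2) * addx k u1 v1 1 u2 v2 1) ((z1\<^sup>2 * z2\<^sup>2) * addy k u1 v1 1 u2 v2 1)
         ((z1\<^sup>2 * z2\<^sup>2) * addz k u1 v1 1 u2 v2 1)"
        unfolding p using assms(1,2) e p
        by (subst proj_scale) (simp, rule cadd_affine, simp_all add: on_cubic_def)
      moreover have "(z1\<^sup>2 * z2\<^sup>2) * addx k u1 v1 1 u2 v2 1 = addx k x1 y1 z1 x2 y2 z2"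
        "(z1\<^sup>2 * z2\<^sup>2) * addy k u1 v1 1 u2 v2 1 = addy k x1 y1 z1 x2 y2 z2"
        "(z1\<^sup>2 * z2\<^sup>2) * addz k u1 v1 1 u2 v2 1 = addz k x1 y1 z1 x2 y2 z2"
        by (simp_all add: e add_defs power2_eq_square algebra_simps)
      ultimately show ?thesis by simp
    qed
  qed
qed

lemma cadd_closed: "on_cubic k P \<Longrightarrow> on_cubic k Q \<Longrightarrow> on_cubic k (cadd k P Q)"
  by (meson add_on_curve proj_cadd proj_curve proj_exists proj_imp_on_cubic)

lemma cadd_commute:
  assumes "on_cubic k P" "on_cubic k Q"
  shows "cadd k P Q = cadd k Q P"
proof -
  obtain x1 y1 z1 x2 y2 z2 where pr: "proj P x1 y1 z1" "proj Q x2 y2 z2"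
    using proj_exists by metis
  note c = pr[THEN proj_curve[rotated]]
  show ?thesis
    by (rule proj_unique[OF proj_cadd[OF assms pr] proj_cadd[OF assms(2,1) pr(2,1)]])
      (rule add_commute_cross[OF c(1)[OF assms(1)] c(2)[OF assms(2)]])+
qed

lemma cadd_assoc:
  assumes "on_cubic k P" "on_cubic k Q" "on_cubic k R"
  shows "cadd k (cadd k P Q) R = cadd k P (cadd k Q R)"
proof -
  obtain x1 y1 z1 x2 y2 z2 x3 y3 z3 where pr: "proj P x1 y1 z1" "proj Q x2 y2 z2" "proj R x3 y3 z3"
    using proj_exists by metis
  have c: "x1 ^ 3 + y1 ^ 3 = k * z1 ^ 3" "x2 ^ 3 + y2 ^ 3 = k * z2 ^ 3" "x3 ^ 3 + y3 ^ 3 = k * z3 ^ 3"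
    using pr assms proj_curve by blast+
  show ?thesis
    by (rule proj_unique[OF proj_cadd[OF cadd_closed assms(3) proj_cadd pr(3)]
          proj_cadd[OF assms(1) cadd_closed pr(1) proj_cadd]])
      (fact assms pr | rule add_assoc_cross[OF c])+
qed

lemma cadd_None: "cadd k None P = P"
  by (cases P) (auto simp: cadd_def third_def cswap_def)

lemma cadd_cswap:
  assumes "on_cubic k P"
  shows "cadd k (cswap P) P = None"
proof -
  obtain x y z where pr: "proj P x y z" using proj_exists by metis
  have "on_cubic k (cswap P)"
    using assms by (auto simp: on_cubic_def cswap_def add.commute split: option.splits)
  from proj_cadd[OF this assms proj_cswap[OF pr] pr]
  have "proj (cadd k (cswap P) P) (addx k y x z x y z) (addy k y x z x y z) (addz k y x z x y z)" .
  moreover have "addz k y x z x y z = 0" by (simp add: addz_def power2_eq_square)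
  ultimately show ?thesis by (auto simp: proj_def split: option.splits)
qed

end

section \<open>The field of Eisenstein numbers\<close>

text \<open>\<open>Eis a b\<close> stands for a + b w.\<close>

datatype eis = Eis (ra: rat) (rb: rat)

lemma eis_eq_iff: "x = y \<longleftrightarrow> ra x = ra y \<and> rb x = rb y"
  by (auto intro: eis.expand)

instantiation eis :: comm_ring_1
begin

definition "0 = Eis 0 0"
definition "1 = Eis 1 0"
definition "x + y = Eis (ra x + ra y) (rb x + rb y)"
definition "- x = Eis (- ra x) (- rb x)"
definition "x - y = Eis (ra x - ra y) (rb x - rb y)"
definition "x * y = Eis (ra x * ra y - rb x * rb y) (ra x * rb y + rb x * ra y - rb x * rb y)"

instance
  by standard (auto simp: zero_eis_def one_eis_def plus_eis_def uminus_eis_def minus_eis_def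
      times_eis_def algebra_simps)

end

lemma eis_sel [simp]:
  "ra 0 = 0" "rb 0 = 0" "ra 1 = 1" "rb 1 = 0"
  "ra (x + y) = ra x + ra y" "rb (x + y) = rb x + rb y"
  "ra (- x) = - ra x" "rb (- x) = - rb x"
  "ra (x - y) = ra x - ra y" "rb (x - y) = rb x - rb y"
  "ra (x * y) = ra x * ra y - rb x * rb y"
  "rb (x * y) = ra x * rb y + rb x * ra y - rb x * rb y"
  by (simp_all add: zero_eis_def one_eis_def plus_eis_def uminus_eis_def minus_eis_def times_eis_def)

definition cj :: "eis \<Rightarrow> eis" where "cj x = Eis (ra x - rb x) (- rb x)"

definition nrm :: "eis \<Rightarrow> rat" where "nrm x = (ra x)\<^sup>2 - ra x * rb x + (rb x)\<^sup>2"

definition om :: eis where "om = Eis 0 1"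

lemma cj_sel [simp]: "ra (cj x) = ra x - rb x" "rb (cj x) = - rb x"
  by (simp_all add: cj_def)

lemma om_sel [simp]: "ra om = 0" "rb om = 1"
  by (simp_all add: om_def)

lemma nrm_eq_0_iff [simp]: "nrm x = 0 \<longleftrightarrow> x = 0"
proof
  assume "nrm x = 0"
  hence "(ra x - rb x)\<^sup>2 + (ra x)\<^sup>2 + (rb x)\<^sup>2 = 0"
    by (simp add: nrm_def power2_eq_square algebra_simps)
  hence "ra x = 0 \<and> rb x = 0"
    by (metis add_nonneg_eq_0_iff power2_eq_iff_nonneg sum_power2_eq_zero_iff zero_le_power2 add_nonneg_nonneg)
  thus "x = 0" by (simp add: eis_eq_iff)
qed (simp add: nrm_def)

instantiation eis :: field
begin

definition "inverse x = Eis ((ra x - rb x) / nrm x) (- rb x / nrm x)"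
definition "x div y = x * inverse (y :: eis)"

instance
proof
  fix x :: eis assume "x \<noteq> 0"
  hence n: "nrm x \<noteq> 0" by simp
  have "ra (inverse x * x) = ((ra x - rb x) * ra x + rb x * rb x) / nrm x"
    by (simp add: inverse_eis_def diff_divide_distrib add_divide_distrib algebra_simps)
  also have "(ra x - rb x) * ra x + rb x * rb x = nrm x"
    by (simp add: nrm_def power2_eq_square algebra_simps)
  finally show "inverse x * x = 1"
    using n by (simp add: eis_eq_iff inverse_eis_def field_simps)
qed (simp_all add: divide_eis_def inverse_eis_def zero_eis_def)

end

lemma of_nat_eis: "(of_nat n :: eis) = Eis (of_nat n) 0"
  by (induction n) (simp_all add: eis_eq_iff)

instance eis :: field_char_0
  by standard (simp add: inj_def of_nat_eis)

text \<open>The trivial Euclidean structure of a field. It leads to the class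
  \<open>field_gcd\<close>, which gives gcds and prime factorisation for polynomials over
  \<open>eis\<close>.\<close>

instantiation eis ::
  "{unique_euclidean_ring, normalization_euclidean_semiring, normalization_semidom_multiplicative}"
begin

definition [simp]: "normalize_eis = (normalize_field :: eis \<Rightarrow> _)"
definition [simp]: "unit_factor_eis = (unit_factor_field :: eis \<Rightarrow> _)"
definition [simp]: "modulo_eis = (mod_field :: eis \<Rightarrow> _)"
definition [simp]: "euclidean_size_eis = (euclidean_size_field :: eis \<Rightarrow> _)"
definition [simp]: "division_segment (x :: eis) = 1"

instance
  by standard
    (simp_all add: dvd_field_iff field_split_simps split: if_splits)

end

instantiation eis :: euclidean_ring_gcd
begin

definition gcd_eis :: "eis \<Rightarrow> eis \<Rightarrow> eis" where "gcd_eis = Euclidean_Algorithm.gcd"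
definition lcm_eis :: "eis \<Rightarrow> eis \<Rightarrow> eis" where "lcm_eis = Euclidean_Algorithm.lcm"
definition Gcd_eis :: "eis set \<Rightarrow> eis" where "Gcd_eis = Euclidean_Algorithm.Gcd"
definition Lcm_eis :: "eis set \<Rightarrow> eis" where "Lcm_eis = Euclidean_Algorithm.Lcm"

instance by standard (simp_all add: gcd_eis_def lcm_eis_def Gcd_eis_def Lcm_eis_def)

end

instance eis :: field_gcd ..

lemma of_int_eis: "(of_int n :: eis) = Eis (of_int n) 0"
  by (cases n) (simp_all add: eis_eq_iff of_nat_eis)

lemma of_rat_eis: "(of_rat q :: eis) = Eis q 0"
proof (cases q)
  case (Fract a b)
  have "(of_rat q :: eis) * of_int b = of_int a"
    using Fract by (simp add: of_rat_rat)
  hence "ra (of_rat q) * of_int b = of_int a" "rb (of_rat q) * of_int b = 0"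
    by (simp_all add: eis_eq_iff of_int_eis)
  moreover have "of_int a = q * of_int b" "of_int b \<noteq> (0 :: rat)"
    using Fract by (simp_all add: Fract_of_int_quotient)
  ultimately have "ra (of_rat q) = q" "rb (of_rat q) = 0"
    by (metis mult_right_cancel, metis mult_eq_0_iff)
  thus ?thesis by (simp add: eis_eq_iff)
qed

lemma of_rat_sel [simp]: "ra (of_rat q) = q" "rb (of_rat q) = 0"
  by (simp_all add: of_rat_eis)

lemma numeral_sel [simp]: "ra (numeral n) = numeral n" "rb (numeral n) = 0"
  using of_rat_sel[of "numeral n"] by (simp_all del: of_rat_sel)

lemma om_cube: "om ^ 3 = 1" and om2: "om\<^sup>2 = - 1 - om"
  by (simp_all add: eis_eq_iff power2_eq_square power3_eq_cube)

lemma cj_hom [simp]: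
  "cj 0 = 0" "cj 1 = 1" "cj (x + y) = cj x + cj y" "cj (x - y) = cj x - cj y" "cj (- x) = - cj x"
  "cj (x * y) = cj x * cj y" "cj (of_rat q) = of_rat q" "cj (cj x) = x" "cj (numeral n) = numeral n"
  by (simp_all add: eis_eq_iff algebra_simps)

lemma cj_power [simp]: "cj (x ^ n) = cj x ^ n"
  by (induction n) auto

lemma cj_om: "cj om = om\<^sup>2"
  by (simp add: eis_eq_iff power2_eq_square)

lemma cj_eq_0_iff [simp]: "cj x = 0 \<longleftrightarrow> x = 0"
  by (auto simp: eis_eq_iff)

lemma mult_cj: "x * cj x = of_rat (nrm x)"
  by (simp add: eis_eq_iff nrm_def power2_eq_square algebra_simps)

lemma nrm_hom [simp]: "nrm (x * y) = nrm x * nrm y" "nrm (cj x) = nrm x" "nrm (- x) = nrm x"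
  "nrm (of_rat q) = q\<^sup>2"
  by (simp_all add: nrm_def power2_eq_square algebra_simps)

lemma nrm_power [simp]: "nrm (x ^ n) = nrm x ^ n"
proof (induction n)
  case 0
  show ?case by (simp add: nrm_def)
qed simp

text \<open>Norms give \<open>s^2 = nrm d ^ 3\<close>, and \<open>s = (s^2)^2 / s^3\<close> is then
  a cube.\<close>

lemma of_rat_cube_eis:
  assumes "of_rat s = (d :: eis) ^ 3"
  obtains t where "s = t ^ 3"
proof (cases "s = 0")
  case True
  thus ?thesis using that[of 0] by simp
next
  case False
  from assms have "s\<^sup>2 = nrm d ^ 3" by (metis nrm_hom(4) nrm_power)
  hence "s = ((nrm d)\<^sup>2 / s) ^ 3"
    using False by (simp add: field_simps power2_eq_square power3_eq_cube)
  thus ?thesis by (rule that)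
qed

section \<open>Polynomials over the Eisenstein numbers\<close>

lemma map_poly_hom:
  fixes f :: "'a::comm_ring_1 \<Rightarrow> 'b::comm_ring_1"
  assumes "f 0 = 0" "\<And>x y. f (x + y) = f x + f y" "\<And>x y. f (x * y) = f x * f y"
  shows "map_poly f (p + q) = map_poly f p + map_poly f q" "map_poly f (p * q) = map_poly f p * map_poly f q"
proof -
  show A: "map_poly f (p + q) = map_poly f p + map_poly f q" for p q
    by (simp add: poly_eq_iff coeff_map_poly assms)
  have S: "map_poly f (smult a p) = smult (f a) (map_poly f p)" for a p
    by (simp add: poly_eq_iff coeff_map_poly assms)
  have C: "map_poly f (pCons a p) = pCons (f a) (map_poly f p)" for a p
    by (rule map_poly_pCons) (rule assms)
  show "map_poly f (p * q) = map_poly f p * map_poly f q"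
    by (induction p) (simp_all add: A S C assms)
qed

abbreviation rp :: "rat poly \<Rightarrow> eis poly" where "rp \<equiv> map_poly of_rat"
abbreviation cjp :: "eis poly \<Rightarrow> eis poly" where "cjp \<equiv> map_poly cj"

lemma rp_hom [simp]: "rp (p + q) = rp p + rp q" "rp (p * q) = rp p * rp q" "rp (- p) = - rp p"
  "rp (p - q) = rp p - rp q" "rp (smult c p) = smult (of_rat c) (rp p)" "rp 1 = 1" "rp (p ^ n) = rp p ^ n"
  "rp (pCons a p) = pCons (of_rat a) (rp p)" "rp (numeral m) = numeral m"
proof -
  note h = map_poly_hom[of of_rat, OF of_rat_0 of_rat_add of_rat_mult]
  show "rp (p + q) = rp p + rp q" "rp (p * q) = rp p * rp q" for p q by (rule h)+
  show u: "rp (- p) = - rp p" for p by (simp add: poly_eq_iff coeff_map_poly of_rat_minus)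
  show "rp (p - q) = rp p - rp q" "rp (smult c p) = smult (of_rat c) (rp p)" "rp 1 = 1"
    by (simp_all add: poly_eq_iff coeff_map_poly of_rat_diff of_rat_mult)
  show "rp (p ^ n) = rp p ^ n"
    by (induction n) (simp_all add: h)
  show c: "rp (pCons a p) = pCons (of_rat a) (rp p)" for a p by (rule map_poly_pCons) simp
  show "rp (numeral m) = numeral m"
    unfolding numeral_poly by (simp add: c)
qed

lemma cjp_hom [simp]: "cjp (p + q) = cjp p + cjp q" "cjp (p * q) = cjp p * cjp q"
  "cjp (smult c p) = smult (cj c) (cjp p)" "cjp (p ^ n) = cjp p ^ n"
  "cjp (pCons a p) = pCons (cj a) (cjp p)" "cjp (rp s) = rp s" "cjp (cjp p) = p"
proof -
  note h = map_poly_hom[of cj, OF cj_hom(1,3,6)]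
  show "cjp (p + q) = cjp p + cjp q" "cjp (p * q) = cjp p * cjp q" for p q by (rule h)+
  show "cjp (smult c p) = smult (cj c) (cjp p)"
    by (simp add: poly_eq_iff coeff_map_poly)
  have "cjp 1 = 1" by simp
  thus "cjp (p ^ n) = cjp p ^ n"
    by (induction n) (simp_all add: h)
  show "cjp (pCons a p) = pCons (cj a) (cjp p)" by (rule map_poly_pCons) simp
  show "cjp (rp s) = rp s" "cjp (cjp p) = p" by (simp_all add: poly_eq_iff coeff_map_poly)
qed

lemma rp_eq_iff [simp]: "rp p = rp q \<longleftrightarrow> p = q"
  by (auto simp: poly_eq_iff coeff_map_poly)

lemma rp_eq_0_iff [simp]: "rp p = 0 \<longleftrightarrow> p = 0"
  by (auto simp: poly_eq_iff coeff_map_poly)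

lemma eis_poly_decompose:
  obtains s t where "g = rp s + smult om (rp t)"
proof
  show "g = rp (map_poly ra g) + smult om (rp (map_poly rb g))"
    by (simp add: poly_eq_iff coeff_map_poly eis_eq_iff)
qed

text \<open>By coprimality each prime has its whole multiplicity in the product, a multiple of 3, in
  one factor. The constant \<open>d\<close> need not be a cube; controlling it is the arithmetic
  part of the descent.\<close>

lemma coprime_mult_eq_cube:
  fixes a b z :: "'a::field_gcd poly"
  assumes "coprime a b" "a * b = smult c (z ^ 3)" "c \<noteq> 0" "z \<noteq> 0"
  obtains d g where "a = smult d (g ^ 3)" "d \<noteq> 0"
proof -
  have nz: "a \<noteq> 0" "b \<noteq> 0" using assms by auto
  have "is_nth_power 3 (normalize a)"
    unfolding is_nth_power_conv_multiplicity[OF zero_less_numeral]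
  proof safe
    fix p :: "'a poly" assume p: "prime p"
    hence pe: "prime_elem p" by blast
    have "multiplicity p a + multiplicity p b = multiplicity p (smult c (z ^ 3))"
      using prime_elem_multiplicity_mult_distrib[OF pe nz] assms(2) by simp
    also have "smult c (z ^ 3) = [:c:] * z ^ 3" by simp
    also have "multiplicity p \<dots> = multiplicity p (z ^ 3)"
      using \<open>c \<noteq> 0\<close> by (intro multiplicity_times_unit_right) (simp add: is_unit_const_poly_iff dvd_field_iff)
    also have "\<dots> = 3 * multiplicity p z"
      using assms(4) by (rule prime_elem_multiplicity_power_distrib[OF pe])
    finally have *: "multiplicity p a + multiplicity p b = 3 * multiplicity p z" .
    have "\<not> (p dvd a \<and> p dvd b)"
      using assms(1) p by (meson coprime_common_divisor not_prime_unit)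
    with * show "3 dvd multiplicity p a"
      using not_dvd_imp_multiplicity_0[of p a] not_dvd_imp_multiplicity_0[of p b] by auto
  qed
  then obtain g where g: "normalize a = g ^ 3" by (auto simp: is_nth_power_def)
  have "a = unit_factor a * g ^ 3" using g by (metis unit_factor_mult_normalize)
  also have "unit_factor a = [:unit_factor (lead_coeff a):]" by (simp add: unit_factor_poly_def)
  finally have "a = smult (unit_factor (lead_coeff a)) (g ^ 3)" by simp
  thus ?thesis using that nz by auto
qed

text \<open>\<open>rb r \<noteq> 0\<close> says that r is irrational, so a remainder of degree below
  2 that vanishes at r is zero. Divisibility by \<open>Q1\<close>, \<open>Q2\<close>,
  \<open>Q3\<close> thus becomes evaluation at a point of K.\<close>

lemma quadratic_dvd_iff_root:
  assumes q: "poly (rp q) r = 0" "degree q = 2" and r: "rb r \<noteq> 0"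
  shows "q dvd p \<longleftrightarrow> poly (rp p) r = 0"
proof
  assume "q dvd p"
  thus "poly (rp p) r = 0" using q(1) by (auto elim!: dvdE)
next
  assume p: "poly (rp p) r = 0"
  define m where "m = p mod q"
  have "p = p div q * q + m" by (simp add: m_def)
  hence "poly (rp m) r = 0" using p q by (metis add_0 mult_zero_right poly_add poly_mult rp_hom(1,2))
  moreover have "degree m < 2 \<or> m = 0"
    using degree_mod_less[of q p] q by (cases "q = 0") (auto simp: m_def)
  then obtain a b where m: "m = [:a, b:]"
    by (metis degree_0 degree_eq_zeroE degree_pCons_eq less_2_cases_iff pCons_cases pCons_0_0
        degree_pCons_0 less_Suc_eq less_one not_less_eq numeral_2_eq_2 pCons_eq_0_iff)
  ultimately have "b = 0" "a = 0" using r by (auto simp: eis_eq_iff)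
  thus "q dvd p" using m by (simp add: m_def mod_eq_0_iff_dvd)
qed

lemma quadratic_prime_elem:
  assumes q: "poly (rp q) r = 0" "degree q = 2" and r: "rb r \<noteq> 0"
  shows "prime_elem q"
proof (rule prime_elemI)
  show "q \<noteq> 0" using q(2) by auto
  show "\<not> q dvd 1" using quadratic_dvd_iff_root[OF assms, of 1] by simp
qed (simp add: quadratic_dvd_iff_root[OF assms])

section \<open>The Mordell-Weil group and homogeneous coordinates\<close>

definition Q1 :: "rat poly" where "Q1 = [:1, -3, 3:]"
definition Q2 :: "rat poly" where "Q2 = [:1, 1, 1:]"
definition Q3 :: "rat poly" where "Q3 = [:3, -3, 1:]"
definition kp :: "rat poly" where "kp = smult 63 (Q1 * Q2 * Q3)"

text \<open>One root from each conjugate pair: coordinates of points are rational polynomials, so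
  the conjugate root carries the same information.\<close>

definition r1 :: eis where "r1 = Eis (2/3) (1/3)"
definition r2 :: eis where "r2 = Eis 0 1"
definition r3 :: eis where "r3 = Eis 2 1"

lemmas Q_defs = Q1_def Q2_def Q3_def
lemmas r_defs = r1_def r2_def r3_def

lemma r_sel [simp]: "ra r1 = 2/3" "rb r1 = 1/3" "ra r2 = 0" "rb r2 = 1" "ra r3 = 2" "rb r3 = 1"
  by (simp_all add: r_defs)

lemma kT_eq: "kT = to_fract kp"
  by (simp add: kT_def to_fract_def kp_def Q_defs numeral_poly)

lemma degree_Q [simp]: "degree Q1 = 2" "degree Q2 = 2" "degree Q3 = 2"
  by (simp_all add: Q_defs)

lemma Q_nz [simp]: "Q1 \<noteq> 0" "Q2 \<noteq> 0" "Q3 \<noteq> 0" "kp \<noteq> 0"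
  by (simp_all add: kp_def Q_defs)

lemma Q_roots [simp]: "poly (rp Q1) r1 = 0" "poly (rp Q2) r2 = 0" "poly (rp Q3) r3 = 0"
  by (simp_all add: Q_defs eis_eq_iff)

lemma Q_dvd_iff: "Q1 dvd p \<longleftrightarrow> poly (rp p) r1 = 0" "Q2 dvd p \<longleftrightarrow> poly (rp p) r2 = 0"
  "Q3 dvd p \<longleftrightarrow> poly (rp p) r3 = 0"
  by (rule quadratic_dvd_iff_root; simp)+

lemma Q_prime: "prime_elem Q1" "prime_elem Q2" "prime_elem Q3"
  by (rule quadratic_prime_elem[OF Q_roots(1)] quadratic_prime_elem[OF Q_roots(2)]
      quadratic_prime_elem[OF Q_roots(3)]; simp)+

lemma Q_coprime: "coprime Q1 Q2" "coprime Q1 Q3" "coprime Q2 Q3"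
proof -
  have "\<not> Q1 dvd Q2" "\<not> Q1 dvd Q3" "\<not> Q2 dvd Q3"
    unfolding Q_dvd_iff by (simp_all add: Q_defs eis_eq_iff)
  thus "coprime Q1 Q2" "coprime Q1 Q3" "coprime Q2 Q3"
    using Q_prime by (auto intro: prime_elem_imp_coprime)
qed

lemma degree_kp: "degree kp = 6"
  by (simp add: kp_def degree_mult_eq)

lemma lead_coeff_kp: "lead_coeff kp = 189"
  by (simp add: kp_def lead_coeff_mult) (simp add: Q_defs numeral_2_eq_2)

lemma squarefree_kp: "squarefree kp"
proof -
  have "squarefree (Q1 * Q2 * Q3)"
    using Q_prime Q_coprime by (intro squarefree_mult_coprime squarefree_prime_elem) auto
  moreover have "kp dvd Q1 * Q2 * Q3"
    unfolding kp_def by (rule smult_dvd) auto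
  ultimately show ?thesis by (rule squarefree_mono[rotated])
qed

text \<open>Every arithmetic obstruction below comes from the 7-adic valuation.\<close>

lemma seven_not_cube:
  fixes x y :: rat and c d :: int
  assumes "of_int (7 * c) * x ^ 3 = of_int d * y ^ 3" "\<not> 7 dvd c" "\<not> 7 dvd d"
  shows "x = 0"
proof (rule ccontr)
  assume x: "x \<noteq> 0"
  obtain a b where ab: "x = of_int a / of_int b" "b \<noteq> 0" by (metis Rat_cases Fract_of_int_quotient less_irrefl)
  obtain e f where ef: "y = of_int e / of_int f" "f \<noteq> 0" by (metis Rat_cases Fract_of_int_quotient less_irrefl)
  have "rat_of_int (7 * c * (a * f) ^ 3) = of_int (d * (e * b) ^ 3)"
    using assms(1) ab ef by (simp add: field_simps)
  hence eq: "7 * c * (a * f) ^ 3 = d * (e * b) ^ 3" by (simp only: of_int_eq_iff)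
  have p: "prime_elem (7::int)" by simp
  have "c \<noteq> 0" "d \<noteq> 0" "a \<noteq> 0" using assms(2,3) x ab by auto
  moreover from this eq ab ef have "e \<noteq> 0" by auto
  moreover have "multiplicity 7 c = 0" "multiplicity 7 d = 0"
    using assms by (auto intro: not_dvd_imp_multiplicity_0)
  moreover have "multiplicity 7 (7::int) = 1" by (simp add: multiplicity_self)
  ultimately have "1 + 3 * multiplicity 7 (a * f) = 3 * multiplicity 7 (e * b)"
    using arg_cong[OF eq, of "multiplicity 7"] ab(2) ef(2) p
    by (simp add: prime_elem_multiplicity_mult_distrib prime_elem_multiplicity_power_distrib)
  thus False by presburger
qed

text \<open>Leading coefficients decide: 189 = 7 * 27 is 7 up to a cube. The degree 6 gives no
  obstruction.\<close>

lemma kp_not_cube: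
  assumes "kp * p ^ 3 = q ^ 3"
  shows "p = 0"
proof -
  have "189 * lead_coeff p ^ 3 = lead_coeff q ^ 3"
    using arg_cong[OF assms, of lead_coeff] by (simp add: lead_coeff_mult lead_coeff_power lead_coeff_kp)
  hence "of_int (7 * 27) * lead_coeff p ^ 3 = of_int 1 * lead_coeff q ^ 3" by simp
  from seven_not_cube[OF this] show ?thesis by simp
qed

interpretation cubic kT
proof
  show "\<forall>m n. kT * m ^ 3 = n ^ 3 \<longrightarrow> m = 0"
  proof safe
    fix m n :: "rat poly fract" assume A: "kT * m ^ 3 = n ^ 3"
    obtain a b where m: "m = Fract a b" "b \<noteq> 0" by (cases m) auto
    obtain c d where n: "n = Fract c d" "d \<noteq> 0" by (cases n) auto
    have "kT * (to_fract a * to_fract d) ^ 3 = (to_fract c * to_fract b) ^ 3"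
      using A m n by (simp add: Fract_conv_to_fract field_simps)
    also have "kT * (to_fract a * to_fract d) ^ 3 = to_fract (kp * (a * d) ^ 3)"
      by (simp add: kT_eq power3_eq_cube)
    also have "(to_fract c * to_fract b) ^ 3 = to_fract ((c * b) ^ 3)"
      by (simp add: power3_eq_cube)
    finally have "kp * (a * d) ^ 3 = (c * b) ^ 3" by (simp only: to_fract_eq_iff)
    thus "m = 0" using kp_not_cube[of "a * d" "c * b"] m n by (simp add: Fract_conv_to_fract)
  qed
qed

text \<open>A type of points makes the \<open>ab_group_add\<close> laws available; the translation
  back to \<open>cindep\<close> happens in \<open>cindep_iff\<close>.\<close>

typedef pt = "{P. on_cubic kT P}"
  by (rule exI[of _ None]) (simp add: on_cubic_def)

lemmas Rep_pt' = Rep_pt[simplified]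

lemma on_cubic_cswap: "on_cubic k (cswap P) \<longleftrightarrow> on_cubic k P"
  by (auto simp: on_cubic_def cswap_def add.commute split: option.splits)

instantiation pt :: ab_group_add
begin

definition "0 = Abs_pt None"
definition "P + Q = Abs_pt (cadd kT (Rep_pt P) (Rep_pt Q))"
definition "- P = Abs_pt (cswap (Rep_pt P))"
definition "P - Q = P + - (Q :: pt)"

lemma Rep_zero: "Rep_pt 0 = None"
  by (simp add: zero_pt_def Abs_pt_inverse on_cubic_def)

lemma Rep_add: "Rep_pt (P + Q) = cadd kT (Rep_pt P) (Rep_pt Q)"
  by (simp add: plus_pt_def Abs_pt_inverse cadd_closed Rep_pt')

lemma Rep_uminus: "Rep_pt (- P) = cswap (Rep_pt P)"
  by (simp add: uminus_pt_def Abs_pt_inverse on_cubic_cswap Rep_pt')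

instance
proof
  fix a b c :: pt
  show "a + b + c = a + (b + c)"
    by (simp add: Rep_add cadd_assoc Rep_pt' flip: Rep_pt_inject)
  show "a + b = b + a"
    by (simp add: Rep_add cadd_commute Rep_pt' flip: Rep_pt_inject)
  show "0 + a = a"
    by (simp add: Rep_add Rep_zero cadd_None flip: Rep_pt_inject)
  show "- a + a = 0"
    by (simp add: Rep_add Rep_zero Rep_uminus cadd_cswap Rep_pt' flip: Rep_pt_inject)
  show "a - b = a + - b" by (rule minus_pt_def)
qed

end

definition hc :: "pt \<Rightarrow> rat poly \<Rightarrow> rat poly \<Rightarrow> rat poly \<Rightarrow> bool" where
  "hc P x y z \<longleftrightarrow> proj (Rep_pt P) (to_fract x) (to_fract y) (to_fract z)"

lemma to_fract_power [simp]: "to_fract (x ^ n) = to_fract x ^ n"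
  by (induction n) simp_all

lemma hc_curve:
  assumes "hc P x y z"
  shows "x ^ 3 + y ^ 3 = kp * z ^ 3"
proof -
  have "to_fract x ^ 3 + to_fract y ^ 3 = kT * to_fract z ^ 3"
    using assms proj_curve[OF Rep_pt'] unfolding hc_def by blast
  hence "to_fract (x ^ 3 + y ^ 3) = to_fract (kp * z ^ 3)"
    by (simp add: kT_eq)
  thus ?thesis by (simp only: to_fract_eq_iff)
qed

lemma hc_nz: "hc P x y z \<Longrightarrow> x \<noteq> 0 \<and> y \<noteq> 0"
  using proj_nz[OF Rep_pt'] unfolding hc_def by (metis to_fract_eq_0_iff)

lemma hc_0: "x \<noteq> 0 \<Longrightarrow> hc 0 x (- x) 0"
  by (simp add: hc_def proj_def Rep_zero)

lemma hc_0_iff: "hc P x y z \<Longrightarrow> P = 0 \<longleftrightarrow> z = 0"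
  by (auto simp: hc_def proj_def Rep_zero simp flip: Rep_pt_inject split: option.splits)

lemma hc_uminus: "hc P x y z \<Longrightarrow> hc (- P) y x z"
  by (simp add: hc_def Rep_uminus proj_cswap)

lemma hc_add:
  assumes "hc P x1 y1 z1" "hc Q x2 y2 z2"
  shows "hc (P + Q) (addx kp x1 y1 z1 x2 y2 z2) (addy kp x1 y1 z1 x2 y2 z2) (addz kp x1 y1 z1 x2 y2 z2)"
  using proj_cadd[OF Rep_pt' Rep_pt' assms[unfolded hc_def]]
  by (simp add: hc_def Rep_add add_defs kT_eq)

lemma hc_scale: "c \<noteq> 0 \<Longrightarrow> hc P (c * x) (c * y) (c * z) \<longleftrightarrow> hc P x y z"
  by (simp add: hc_def proj_scale)

lemma hc_unique:
  assumes "hc P x y z" "hc Q x' y' z'" "x * y' = x' * y" "x * z' = x' * z" "y * z' = y' * z"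
  shows "P = Q"
proof -
  have "to_fract (x * y') = to_fract (x' * y)" "to_fract (x * z') = to_fract (x' * z)"
    "to_fract (y * z') = to_fract (y' * z)" using assms(3-5) by simp_all
  thus ?thesis using proj_unique assms(1,2) unfolding hc_def to_fract_mult
    by (metis Rep_pt_inject)
qed

text \<open>The curve equation determines \<open>kp * z ^ 3\<close> from x and y, and cube roots are
  unique, so the ratio x : y already fixes the point.\<close>

lemma hc_cross_cube:
  assumes "hc P x y z" "hc Q x' y' z'" "x * y' = x' * y"
  shows "P = Q"
proof (rule hc_unique[OF assms])
  note c = hc_curve[OF assms(1)] hc_curve[OF assms(2)]
  note nz = hc_nz[OF assms(1)] hc_nz[OF assms(2)]
  have "kp * (x * z') ^ 3 = x ^ 3 * (x' ^ 3 + y' ^ 3)"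
    unfolding c by (simp add: power_mult_distrib)
  also have "\<dots> = (x * x') ^ 3 + (x * y') ^ 3" by (simp add: power_mult_distrib algebra_simps)
  also have "\<dots> = x' ^ 3 * (x ^ 3 + y ^ 3)"
    unfolding assms(3) by (simp add: power_mult_distrib algebra_simps)
  also have "\<dots> = kp * (x' * z) ^ 3" unfolding c by (simp add: power_mult_distrib)
  finally show xz: "x * z' = x' * z" by (simp add: cube_eq_iff)
  have "x * (y * z') = x * (y' * z)" using xz assms(3) by algebra
  thus "y * z' = y' * z" using nz by simp
qed

lemma hc_ex:
  assumes "x ^ 3 + y ^ 3 = kp * z ^ 3" "x \<noteq> 0"
  obtains P where "hc P x y z"
proof -
  have "to_fract (x ^ 3 + y ^ 3) = to_fract (kp * z ^ 3)" using assms by simp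
  hence "to_fract x ^ 3 + to_fract y ^ 3 = kT * to_fract z ^ 3" by (simp add: kT_eq)
  with proj_ex[of "to_fract x" "to_fract y" "to_fract z"] assms(2)
  obtain P where "on_cubic kT P" "proj P (to_fract x) (to_fract y) (to_fract z)" by auto
  thus ?thesis using that[of "Abs_pt P"] by (simp add: hc_def Abs_pt_inverse)
qed

lemma hc_exists: "\<exists>x y z. hc P x y z"
proof (cases "Rep_pt P")
  case None
  hence "hc P 1 (-1) 0" by (simp add: hc_def proj_def)
  thus ?thesis by blast
next
  case (Some p)
  obtain a b where a: "fst p = Fract a b" "b \<noteq> 0" by (cases "fst p") auto
  obtain c d where c: "snd p = Fract c d" "d \<noteq> 0" by (cases "snd p") auto
  have "hc P (a * d) (c * b) (b * d)"
    using Some a c by (simp add: hc_def proj_def case_prod_unfold Fract_conv_to_fract)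
  thus ?thesis by blast
qed

text \<open>As \<open>kp\<close> is squarefree, a prime with multiplicity m in \<open>d\<close> and
  n in \<open>z\<close> satisfies 3m \<le> 1 + 3n, hence m \<le> n. A common factor of x and y
  therefore cancels from z too, which is why \<open>prim\<close> asks only for coprime x and
  y.\<close>

lemma cube_dvd_imp_dvd:
  assumes "d ^ 3 dvd kp * z ^ 3"
  shows "d dvd z"
proof (cases "z = 0")
  case False
  hence d: "d \<noteq> 0" using assms by auto
  show ?thesis
  proof (rule multiplicity_le_imp_dvd[OF d])
    fix p :: "rat poly" assume p: "prime p"
    hence pe: "prime_elem p" by blast
    have "multiplicity p (d ^ 3) \<le> multiplicity p (kp * z ^ 3)"
      using assms False by (intro dvd_imp_multiplicity_le) auto
    hence "3 * multiplicity p d \<le> multiplicity p kp + 3 * multiplicity p z"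
      using False d pe by (simp add: prime_elem_multiplicity_mult_distrib prime_elem_multiplicity_power_distrib)
    moreover have "multiplicity p kp \<le> 1"
      using squarefree_kp p squarefree_factorial_semiring'[of kp]
      by (metis One_nat_def Q_nz(4) le_SucI le_refl not_dvd_imp_multiplicity_0 prime_factorsI zero_le_one)
    ultimately show "multiplicity p d \<le> multiplicity p z" by linarith
  qed
qed simp

definition prim :: "pt \<Rightarrow> rat poly \<Rightarrow> rat poly \<Rightarrow> rat poly \<Rightarrow> bool" where
  "prim P x y z \<longleftrightarrow> hc P x y z \<and> coprime x y"

lemma hc_prim:
  assumes "hc P x y z"
  obtains d x' y' z' where "prim P x' y' z'" "x = d * x'" "y = d * y'" "z = d * z'" "d \<noteq> 0"
proof -
  define d where "d = gcd x y"
  have d: "d \<noteq> 0" using hc_nz[OF assms] by (simp add: d_def)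
  obtain x' y' where xy: "x = d * x'" "y = d * y'" "coprime x' y'"
    using gcd_coprime_exists[of x y] d unfolding d_def by (metis mult.commute)
  have "kp * z ^ 3 = d ^ 3 * (x' ^ 3 + y' ^ 3)"
    unfolding hc_curve[OF assms, symmetric] xy by (simp add: power_mult_distrib algebra_simps)
  hence "d dvd z" using cube_dvd_imp_dvd by (metis dvd_triv_left)
  then obtain z' where z: "z = d * z'" by (auto elim: dvdE)
  have "prim P x' y' z'"
    using assms d unfolding prim_def xy z by (simp add: hc_scale xy)
  thus ?thesis using that xy z d by blast
qed

lemma prim_exists: "\<exists>x y z. prim P x y z"
  using hc_exists hc_prim by metis

section \<open>The height\<close>

definition ht :: "pt \<Rightarrow> nat" where
  "ht P = (SOME n. \<exists>x y z. prim P x y z \<and> n = max (degree x) (degree y))"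

lemma hc_cross:
  assumes "hc P x y z" "hc P x' y' z'"
  shows "x * y' = x' * y"
proof -
  have "to_fract (x * y') = to_fract (x' * y)"
    using assms by (auto simp: hc_def proj_def split: option.splits)
  thus ?thesis by (simp only: to_fract_eq_iff)
qed

lemma ht_prim:
  assumes "prim P x y z"
  shows "ht P = max (degree x) (degree y)"
proof -
  have "max (degree x') (degree y') = max (degree x) (degree y)" if "prim P x' y' z'" for x' y' z'
  proof -
    have c: "coprime x y" "coprime x' y'" "x * y' = x' * y"
      using assms that hc_cross[of P x y z x' y' z'] by (auto simp: prim_def)
    hence "x dvd x'" by (metis coprime_dvd_mult_left_iff dvd_triv_left)
    moreover from c have "x' dvd x" by (metis coprime_dvd_mult_left_iff dvd_triv_left)
    moreover from c have "y dvd y'" by (metis coprime_commute coprime_dvd_mult_right_iff dvd_triv_right)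
    moreover from c have "y' dvd y" by (metis coprime_commute coprime_dvd_mult_right_iff dvd_triv_right)
    moreover have "x \<noteq> 0" "y \<noteq> 0" "x' \<noteq> 0" "y' \<noteq> 0" using assms that hc_nz by (auto simp: prim_def)
    ultimately have "degree x = degree x'" "degree y = degree y'"
      by (simp_all add: dvd_imp_degree_le le_antisym)
    thus ?thesis by simp
  qed
  thus ?thesis using assms unfolding ht_def by (intro some_equality) blast+
qed

text \<open>\<open>kp\<close> has degree 6, so z costs 2 more than its degree. With n = 0 no nonzero
  z remains, which is why only O has height 0.\<close>

lemma degree_z:
  assumes "hc P x y z" "z \<noteq> 0" "degree x \<le> n" "degree y \<le> n"
  shows "degree z + 2 \<le> n"
proof -
  have "6 + 3 * degree z = degree (kp * z ^ 3)"
    using assms(2) by (simp add: degree_mult_eq degree_power_eq degree_kp)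
  also have "\<dots> = degree (x ^ 3 + y ^ 3)" using hc_curve[OF assms(1)] by simp
  also have "\<dots> \<le> 3 * n"
    using assms(3,4) hc_nz[OF assms(1)] by (intro degree_add_le) (simp_all add: degree_power_eq)
  finally show ?thesis by linarith
qed

lemma ht_eq_0_iff: "ht P = 0 \<longleftrightarrow> P = 0"
proof
  assume "ht P = 0"
  obtain x y z where p: "prim P x y z" using prim_exists by blast
  with \<open>ht P = 0\<close> ht_prim[OF p] have "z = 0"
    using degree_z[of P x y z 0] by (auto simp: prim_def)
  thus "P = 0" using p hc_0_iff by (auto simp: prim_def)
next
  assume "P = 0"
  hence "prim P 1 (-1) 0" using hc_0[of 1] by (simp add: prim_def)
  from ht_prim[OF this] show "ht P = 0" by simp
qed

lemma ht_uminus [simp]: "ht (- P) = ht P"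
proof -
  obtain x y z where p: "prim P x y z" using prim_exists by blast
  hence "prim (- P) y x z" by (auto simp: prim_def hc_uminus coprime_commute)
  from ht_prim[OF this] ht_prim[OF p] show ?thesis by (simp add: max.commute)
qed

lemma numeral_mult_poly: "(numeral n :: rat poly) * p = smult (numeral n) p"
  by (simp add: numeral_poly)

text \<open>Duplication sends x : y to y (2 x^3 + y^3) : - x (x^3 + 2 y^3). These forms of degree 4
  stay coprime when x and y are, so no height is lost to cancellation.\<close>

lemma ht_double: "ht (P + P) = 4 * ht P"
proof -
  obtain x y z where p: "prim P x y z" using prim_exists by blast
  hence h: "hc P x y z" and cop: "coprime x y" by (auto simp: prim_def)
  define u where "u = 2 * x ^ 3 + y ^ 3"
  define v where "v = x ^ 3 + 2 * y ^ 3"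
  have X: "addx kp x y z x y z = y * u"
    using hc_curve[OF h] unfolding addx_def u_def by algebra
  have Y: "addy kp x y z x y z = x * (- v)"
    using hc_curve[OF h] unfolding addy_def v_def by algebra
  have h2: "hc (P + P) (y * u) (x * (- v)) (addz kp x y z x y z)"
    using hc_add[OF h h] unfolding X Y .
  have yv: "coprime y v"
  proof (rule coprimeI)
    fix c assume c: "c dvd y" "c dvd v"
    hence "c dvd x ^ 3" unfolding v_def by (metis c(1) dvd_add_left_iff dvd_mult dvd_power_same dvd_power dvd_trans zero_less_numeral)
    moreover have "coprime c (x ^ 3)" using cop c(1) by (metis coprime_commute coprime_divisors coprime_power_right_iff dvd_refl)
    ultimately show "is_unit c" by (metis coprime_absorb_left)
  qed
  have xu: "coprime x u"
  proof (rule coprimeI)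
    fix c assume c: "c dvd x" "c dvd u"
    hence "c dvd y ^ 3" unfolding u_def by (metis c(1) dvd_add_right_iff dvd_mult dvd_power dvd_trans zero_less_numeral)
    moreover have "coprime c (y ^ 3)" using cop c(1) by (metis coprime_divisors coprime_power_right_iff dvd_refl)
    ultimately show "is_unit c" by (metis coprime_absorb_left)
  qed
  have uv: "coprime u v"
  proof (rule coprimeI)
    fix c assume c: "c dvd u" "c dvd v"
    have "2 * u - v = 3 * x ^ 3" by (simp add: u_def v_def)
    hence "c dvd smult 3 (x ^ 3)" using c by (metis dvd_diff dvd_mult numeral_mult_poly)
    hence "c dvd x ^ 3" by (simp add: dvd_smult_iff)
    moreover have "coprime c (x ^ 3)" using xu c(1) by (metis coprime_commute coprime_divisors coprime_power_right_iff dvd_refl)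
    ultimately show "is_unit c" by (metis coprime_absorb_left)
  qed
  have "coprime (y * u) (x * (- v))"
    using yv xu uv cop by (auto simp: coprime_mult_left_iff coprime_mult_right_iff coprime_commute)
  hence "prim (P + P) (y * u) (x * (- v)) (addz kp x y z x y z)" using h2 by (simp add: prim_def)
  from ht_prim[OF this] have ht2: "ht (P + P) = max (degree (y * u)) (degree (x * - v))" .
  have nz: "x \<noteq> 0" "y \<noteq> 0" using hc_nz[OF h] by auto
  have nz': "u \<noteq> 0" "v \<noteq> 0" using hc_nz[OF h2] by auto
  have dm: "degree (y * u) = degree y + degree u" "degree (x * - v) = degree x + degree v"
    using nz nz' by (simp_all add: degree_mult_eq)
  have d3: "degree (2 * x ^ 3) = 3 * degree x" "degree (2 * y ^ 3) = 3 * degree y"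
    "degree (x ^ 3) = 3 * degree x" "degree (y ^ 3) = 3 * degree y"
    using nz by (simp_all add: numeral_mult_poly degree_power_eq)
  consider "degree x < degree y" | "degree y < degree x" | "degree x = degree y" by linarith
  hence "max (degree (y * u)) (degree (x * - v)) = 4 * max (degree x) (degree y)"
  proof cases
    case 1
    hence "degree u = 3 * degree y" "degree v = 3 * degree y"
      unfolding u_def v_def by (simp_all add: degree_add_eq_right d3)
    thus ?thesis using 1 dm by simp
  next
    case 2
    hence "degree u = 3 * degree x" "degree v = 3 * degree x"
      unfolding u_def v_def by (simp_all add: degree_add_eq_left d3)
    thus ?thesis using 2 dm by simp
  next
    case 3
    define n where "n = degree x"
    have le: "degree u \<le> 3 * n" "degree v \<le> 3 * n"
      unfolding u_def v_def using 3 by (auto intro!: degree_add_le simp: d3 n_def)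
    have c: "coeff (x ^ 3) (3 * n) = lead_coeff x ^ 3" "coeff (y ^ 3) (3 * n) = lead_coeff y ^ 3"
      using d3(3,4) 3 lead_coeff_power[of x 3] lead_coeff_power[of y 3] by (simp_all add: n_def)
    \<comment> \<open>For cubes a, b of the leading coefficients, 2a + b and a + 2b vanish together
      only if a = b = 0, so at least one of \<open>u\<close>, \<open>v\<close> keeps its full
      degree.\<close>
    have "coeff u (3 * n) = 2 * lead_coeff x ^ 3 + lead_coeff y ^ 3"
      "coeff v (3 * n) = lead_coeff x ^ 3 + 2 * lead_coeff y ^ 3"
      by (simp_all add: u_def v_def c numeral_mult_poly)
    moreover have "lead_coeff x ^ 3 \<noteq> 0" using nz by simp
    ultimately have "coeff u (3 * n) \<noteq> 0 \<or> coeff v (3 * n) \<noteq> 0" by (auto simp: add_eq_0_iff)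
    hence "degree u = 3 * n \<or> degree v = 3 * n" using le by (meson le_antisym le_degree)
    thus ?thesis using le 3 dm by (auto simp: n_def)
  qed
  thus ?thesis using ht2 ht_prim[OF p] by simp
qed

text \<open>
  The coordinate z has weight 2 and k has weight -6, so that the curve equation is homogeneous.
\<close>

definition wdeg :: "rat poly \<Rightarrow> int \<Rightarrow> int \<Rightarrow> bool" where
  "wdeg p w n \<longleftrightarrow> p = 0 \<or> int (degree p) + w \<le> n"

lemma wdeg_mult: "wdeg p v m \<Longrightarrow> wdeg q w n \<Longrightarrow> wdeg (p * q) (v + w) (m + n)"
  by (cases "p = 0"; cases "q = 0") (auto simp: wdeg_def degree_mult_eq)

lemma wdeg_add: "wdeg p w n \<Longrightarrow> wdeg q w n \<Longrightarrow> wdeg (p + q) w n"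
  using degree_add_le_max[of p q] by (fastforce simp: wdeg_def)

lemma wdeg_uminus: "wdeg (- p) w n \<longleftrightarrow> wdeg p w n"
  by (simp add: wdeg_def)

lemma wdeg_diff: "wdeg p w n \<Longrightarrow> wdeg q w n \<Longrightarrow> wdeg (p - q) w n"
  using wdeg_add[of p w n "- q"] by (simp add: wdeg_uminus)

lemma wdeg_kp: "wdeg kp (- 6) 0"
  by (simp add: wdeg_def degree_kp)

lemma prim_wdeg:
  assumes "prim P x y z"
  shows "wdeg x 0 (ht P)" "wdeg y 0 (ht P)" "wdeg z 2 (ht P)"
proof -
  show "wdeg x 0 (ht P)" "wdeg y 0 (ht P)" using ht_prim[OF assms] by (auto simp: wdeg_def)
  show "wdeg z 2 (ht P)"
    using ht_prim[OF assms] degree_z[of P x y z "ht P"] assms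
    by (cases "z = 0") (auto simp: wdeg_def prim_def)
qed

text \<open>
  The products of a coordinate of P + Q with a coordinate of P - Q are, up to the common factor
  \<open>addy\<close>, forms of bidegree (2, 2) in P and Q: they are the different bidegree (2, 2) addition laws.
\<close>

lemma addlaw_products:
  fixes k :: "'a::idom"
  assumes "x1 ^ 3 + y1 ^ 3 = k * z1 ^ 3" "x2 ^ 3 + y2 ^ 3 = k * z2 ^ 3"
  defines "F \<equiv> addx k x1 y1 z1 x2 y2 z2" and "F' \<equiv> addy k x1 y1 z1 x2 y2 z2"
    and "G \<equiv> addx k x1 y1 z1 y2 x2 z2" and "G' \<equiv> addy k x1 y1 z1 y2 x2 z2"
  shows "F * G = F' * (- (k * y1 * z1 * z2\<^sup>2) - x1\<^sup>2 * x2 * y2)"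
    "F' * G = F' * (x1 * y1 * y2\<^sup>2 + k * z1\<^sup>2 * x2 * z2)" "G' = F'"
proof -
  show "F * G = F' * (- (k * y1 * z1 * z2\<^sup>2) - x1\<^sup>2 * x2 * y2)"
    using assms(1,2) unfolding assms(3-) add_defs by algebra
  show "F' * G = F' * (x1 * y1 * y2\<^sup>2 + k * z1\<^sup>2 * x2 * z2)" "G' = F'"
    unfolding assms(3-) add_defs by algebra+
qed

text \<open>Once the common factors \<open>d\<close> and \<open>e\<close> are split off the
  coordinates of P + Q and P - Q, each product of a reduced coordinate of P + Q with one of P - Q
  divides a form of bidegree (2, 2) in P and Q, whose degree is bounded by the right-hand
  side.\<close>

lemma ht_parallelogram_le: "ht (P + Q) + ht (P - Q) \<le> 2 * ht P + 2 * ht Q"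
proof -
  obtain x1 y1 z1 where p: "prim P x1 y1 z1" using prim_exists by blast
  obtain x2 y2 z2 where q: "prim Q x2 y2 z2" using prim_exists by blast
  have hp: "hc P x1 y1 z1" and hq: "hc Q x2 y2 z2" using p q by (auto simp: prim_def)
  define F F' G M11 M21
    where "F = addx kp x1 y1 z1 x2 y2 z2" and "F' = addy kp x1 y1 z1 x2 y2 z2"
      and "G = addx kp x1 y1 z1 y2 x2 z2"
      and "M11 = - (kp * y1 * z1 * z2\<^sup>2) - x1\<^sup>2 * x2 * y2"
      and "M21 = x1 * y1 * y2\<^sup>2 + kp * z1\<^sup>2 * x2 * z2"
  note M_defs = F_def F'_def M11_def M21_def add_defs
  note prods = addlaw_products[OF hc_curve[OF hp] hc_curve[OF hq], folded F_def F'_def G_def M11_def M21_def]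
  have h1: "hc (P + Q) F F' (addz kp x1 y1 z1 x2 y2 z2)"
    using hc_add[OF hp hq] by (simp add: F_def F'_def)
  have h2: "hc (P - Q) G F' (addz kp x1 y1 z1 y2 x2 z2)"
    using hc_add[OF hp hc_uminus[OF hq]] by (simp add: G_def prods(3))
  obtain d a b c where d: "prim (P + Q) a b c" "F = d * a" "F' = d * b" "d \<noteq> 0"
    using hc_prim[OF h1] by metis
  obtain e a' b' c' where e: "prim (P - Q) a' b' c'" "G = e * a'" "F' = e * b'" "e \<noteq> 0"
    using hc_prim[OF h2] by metis
  have F': "F' \<noteq> 0" using hc_nz[OF h1] by simp
  have cop: "coprime a b" "coprime a' b'" using d(1) e(1) by (auto simp: prim_def)
  \<comment> \<open>All four products are multiples of \<open>F'\<close>. Removing the coprime pair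
    \<open>a'\<close>, \<open>b'\<close> and then the coprime pair \<open>a\<close>,
    \<open>b\<close> leaves \<open>F' dvd d * e\<close>.\<close>
  have "F' dvd (d * e * a) * a'" "F' dvd (d * e * a) * b'"
    "F' dvd (d * e * b) * a'" "F' dvd (d * e * b) * b'"
  proof -
    have "d * e * a * a' = F * G" "d * e * b * a' = F' * G" "d * e * a * b' = F * F'" "d * e * b * b' = F' * F'"
      using d e by (simp_all add: ac_simps)
    thus "F' dvd (d * e * a) * a'" "F' dvd (d * e * a) * b'"
      "F' dvd (d * e * b) * a'" "F' dvd (d * e * b) * b'"
      using prods(1) by simp_all
  qed
  moreover have dvd_of_coprime: "s dvd m" if "s dvd m * u" "s dvd m * v" "coprime u v" for s m u v :: "rat poly"
  proof -
    have "s dvd gcd (m * u) (m * v)" using that by simp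
    also have "gcd (m * u) (m * v) dvd m" using that(3)
      by (metis gcd_mult_left coprime_iff_gcd_eq_1 dvd_refl mult.right_neutral normalize_dvd_iff)
    finally show ?thesis .
  qed
  ultimately have "F' dvd d * e * a" "F' dvd d * e * b"
    using cop(2) by blast+
  hence "F' dvd d * e" using dvd_of_coprime cop(1) by blast
  then obtain s where s: "d * e = F' * s" by (auto elim: dvdE)
  have s0: "s \<noteq> 0" using s d(4) e(4) by auto
  have "F' * M11 = F' * (s * (a * a'))" "F' * M21 = F' * (s * (b * a'))"
    "F' * F = F' * (s * (a * b'))" "F' * F' = F' * (s * (b * b'))"
    using prods(1,2) d e s by algebra+
  hence M: "M11 = s * (a * a')" "M21 = s * (b * a')" "F = s * (a * b')" "F' = s * (b * b')"
    using F' by simp_all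
  have nz: "a \<noteq> 0" "b \<noteq> 0" "a' \<noteq> 0" "b' \<noteq> 0"
    using d(1) e(1) hc_nz by (auto simp: prim_def)
  define m where "m = int (2 * ht P + 2 * ht Q)"
  note w1 = prim_wdeg[OF p] and w2 = prim_wdeg[OF q]
  \<comment> \<open>Every monomial has bidegree (2, 2) and total weight 0: the weight -6 of
    \<open>kp\<close> always comes with exactly three factors z.\<close>
  have "wdeg M11 0 m" "wdeg M21 0 m" "wdeg F 0 m" "wdeg F' 0 m"
  proof -
    have w: "wdeg r 0 m" if "wdeg r w n" "w = 0" "n = m" for r w n using that by simp
    show "wdeg M11 0 m" unfolding M_defs power2_eq_square
      by (intro wdeg_diff wdeg_uminus[THEN iffD2]; rule w, (rule wdeg_mult wdeg_kp w1 w2)+; simp add: m_def)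
    show "wdeg M21 0 m" unfolding M_defs power2_eq_square
      by (intro wdeg_add; rule w, (rule wdeg_mult wdeg_kp w1 w2)+; simp add: m_def)
    show "wdeg F 0 m" unfolding M_defs power2_eq_square
      by (intro wdeg_add; rule w, (rule wdeg_mult wdeg_kp w1 w2)+; simp add: m_def)
    show "wdeg F' 0 m" unfolding M_defs power2_eq_square
      by (intro wdeg_diff wdeg_uminus[THEN iffD2]; rule w, (rule wdeg_mult wdeg_kp w1 w2)+; simp add: m_def)
  qed
  hence "degree a + degree a' \<le> 2 * ht P + 2 * ht Q" "degree b + degree a' \<le> 2 * ht P + 2 * ht Q"
    "degree a + degree b' \<le> 2 * ht P + 2 * ht Q" "degree b + degree b' \<le> 2 * ht P + 2 * ht Q"
    unfolding M using nz s0 by (simp_all add: wdeg_def m_def degree_mult_eq)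
  thus ?thesis unfolding ht_prim[OF d(1)] ht_prim[OF e(1)] by linarith
qed

text \<open>The inequality, applied to P + Q and P - Q with sum 2P and difference 2Q, reverses
  itself because doubling multiplies heights by exactly 4.\<close>

lemma ht_parallelogram: "ht (P + Q) + ht (P - Q) = 2 * ht P + 2 * ht Q"
proof (rule antisym[OF ht_parallelogram_le])
  have "(P + Q) + (P - Q) = P + P" "(P + Q) - (P - Q) = Q + Q" by (simp_all add: algebra_simps)
  with ht_parallelogram_le[of "P + Q" "P - Q"] ht_double[of P] ht_double[of Q]
  show "2 * ht P + 2 * ht Q \<le> ht (P + Q) + ht (P - Q)" by simp
qed

lemma ht_triple: "ht (P + P + P) = 9 * ht P"
  using ht_parallelogram[of "P + P" P] ht_double[of P] by simp

lemma triple_eq_0_iff: "P + P + P = 0 \<longleftrightarrow> (P :: pt) = 0"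
  using ht_triple[of P] ht_eq_0_iff by (metis mult_eq_0_iff zero_neq_numeral)

text \<open>Five uses of the parallelogram law. For summands of height at most h it bounds the
  height of the sum by 9h, strictly once two summands differ, and 9 is also the factor of
  tripling.\<close>

lemma ht_sum3: "ht (P + Q + R) + ht (P - Q) + ht (Q - R) + ht (P - R) = 3 * (ht P + ht Q + ht R)"
proof -
  have e: "(P + Q) + R = P + Q + R" "(P + Q) - R = (P - R) + Q" "(P - R) - Q = (P - Q) - R"
    "(P - Q) + R = P - (Q - R)" "P + (Q - R) = (P - R) + Q"
    by (simp_all add: algebra_simps)
  have "ht (P + Q + R) + ht (P - R + Q) = 2 * ht (P + Q) + 2 * ht R"
    using ht_parallelogram[of "P + Q" R] e by simp
  moreover have "ht (P - R + Q) + ht (P - (Q - R)) = 2 * ht P + 2 * ht (Q - R)"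
    using ht_parallelogram[of P "Q - R"] e by simp
  moreover have "ht (P - (Q - R)) + ht (P - R - Q) = 2 * ht (P - Q) + 2 * ht R"
    using ht_parallelogram[of "P - Q" R] unfolding e(3,4) .
  moreover have "ht (P - R + Q) + ht (P - R - Q) = 2 * ht (P - R) + 2 * ht Q"
    using ht_parallelogram[of "P - R" Q] by simp
  moreover note ht_parallelogram[of P Q]
  moreover have "S + Z + Y + X = 3 * (p + q + r)"
    if "S + A = 2 * W + 2 * r" "A + B = 2 * p + 2 * Y" "B + C = 2 * Z + 2 * r" "A + C = 2 * X + 2 * q"
      "W + Z = 2 * p + 2 * q" for S A B C W X Y Z p q r :: nat
    using that by simp
  ultimately show ?thesis by blast
qed

section \<open>Descent modulo 3\<close>

lemma poly_rp_kp [simp]: "poly (rp kp) r1 = 0" "poly (rp kp) r2 = 0" "poly (rp kp) r3 = 0"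
  by (simp_all add: kp_def)

definition kroots :: "eis set" where "kroots = {r1, r2, r3}"

lemma kroots_prime:
  assumes "r \<in> kroots"
  obtains q where "prime_elem q" "\<And>p. q dvd p \<longleftrightarrow> poly (rp p) r = 0"
  using assms Q_prime Q_dvd_iff by (auto simp: kroots_def)

lemma coprime_roots:
  assumes "r \<in> kroots" "coprime x y" "poly (rp x) r = 0"
  shows "poly (rp y) r \<noteq> 0"
  using kroots_prime[OF assms(1)] assms(2,3) by (metis coprime_common_divisor prime_elem_not_unit)

definition rho :: "eis \<Rightarrow> pt \<Rightarrow> eis" where
  "rho r P = (SOME v. \<exists>x y z. hc P x y z \<and> poly (rp y) r \<noteq> 0 \<and> v = - poly (rp x) r / poly (rp y) r)"

lemma rho_eq:
  assumes "hc P x y z" "poly (rp y) r \<noteq> 0"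
  shows "rho r P = - poly (rp x) r / poly (rp y) r"
proof -
  have "- poly (rp x') r / poly (rp y') r = - poly (rp x) r / poly (rp y) r"
    if "hc P x' y' z'" "poly (rp y') r \<noteq> 0" for x' y' z'
  proof -
    have "poly (rp (x' * y)) r = poly (rp (x * y')) r" using hc_cross[OF that(1) assms(1)] by simp
    thus ?thesis using that(2) assms(2) by (simp add: field_simps)
  qed
  thus ?thesis using assms unfolding rho_def by (intro some_equality) blast+
qed

lemma prim_roots:
  assumes "prim P x y z" "r \<in> kroots"
  shows "poly (rp x) r \<noteq> 0" "poly (rp y) r \<noteq> 0" "poly (rp x) r ^ 3 + poly (rp y) r ^ 3 = 0"
proof -
  have c: "coprime x y" "hc P x y z" using assms by (auto simp: prim_def)
  have "poly (rp (x ^ 3 + y ^ 3)) r = poly (rp (kp * z ^ 3)) r" using hc_curve[OF c(2)] by simp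
  also have "\<dots> = 0" using assms(2) by (auto simp: kroots_def)
  finally show s: "poly (rp x) r ^ 3 + poly (rp y) r ^ 3 = 0" by simp
  show "poly (rp x) r \<noteq> 0"
  proof
    assume "poly (rp x) r = 0"
    with coprime_roots[OF assms(2) c(1)] s show False by simp
  qed
  with s show "poly (rp y) r \<noteq> 0" by auto
qed

lemma rho_prim:
  assumes "prim P x y z" "r \<in> kroots"
  shows "poly (rp x) r = - rho r P * poly (rp y) r"
  using rho_eq[of P x y z r] prim_roots[OF assms] assms(1) by (simp add: prim_def)

lemma rho_cube:
  assumes "r \<in> kroots"
  shows "rho r P ^ 3 = 1"
proof -
  obtain x y z where p: "prim P x y z" using prim_exists by blast
  from prim_roots(3)[OF this assms] rho_prim[OF this assms]
  have "poly (rp y) r ^ 3 * (1 - rho r P ^ 3) = 0" by (simp add: power_mult_distrib algebra_simps)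
  thus ?thesis using prim_roots(2)[OF p assms] by simp
qed

text \<open>At a root of k only the terms free of k survive in the addition law, and X : Y becomes
  x1 x2 : - y1 y2.\<close>

lemma rho_add:
  assumes "r \<in> kroots"
  shows "rho r (P + Q) = rho r P * rho r Q"
proof -
  obtain x1 y1 z1 where p: "prim P x1 y1 z1" using prim_exists by blast
  obtain x2 y2 z2 where q: "prim Q x2 y2 z2" using prim_exists by blast
  have h: "hc P x1 y1 z1" "hc Q x2 y2 z2" using p q by (auto simp: prim_def)
  have k: "poly (rp kp) r = 0" using assms by (auto simp: kroots_def)
  note n = prim_roots(1,2)[OF p assms] prim_roots(1,2)[OF q assms]
  have "rho r (P + Q) = - poly (rp (addx kp x1 y1 z1 x2 y2 z2)) r / poly (rp (addy kp x1 y1 z1 x2 y2 z2)) r"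
    using n by (intro rho_eq[OF hc_add[OF h]]) (simp add: add_defs k)
  also have "\<dots> = (- poly (rp x1) r / poly (rp y1) r) * (- poly (rp x2) r / poly (rp y2) r)"
    using n by (simp add: add_defs k power2_eq_square field_simps)
  also have "\<dots> = rho r P * rho r Q" using rho_eq h n by simp
  finally show ?thesis .
qed

lemma rho_0: "r \<in> kroots \<Longrightarrow> rho r 0 = 1"
  using rho_eq[OF hc_0[of 1], of r] by simp

lemma rho_uminus: "r \<in> kroots \<Longrightarrow> rho r (- P) = inverse (rho r P)"
  using rho_add[of r P "- P"] rho_0[of r] by (simp add: inverse_unique[symmetric])

section \<open>Linear factors of x^3 + y^3 over K\<close>

lemma eis_cube_root_1:
  fixes t :: eis
  assumes "t ^ 3 = 1"
  shows "t = 1 \<or> t = om \<or> t = om\<^sup>2"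
proof -
  have "om * om * om = 1" using om_cube by (simp add: power3_eq_cube)
  have "(t - 1) * (t - om) * (t - om\<^sup>2) = t ^ 3 - (1 + om + om\<^sup>2) * (t\<^sup>2 - om * t) - om ^ 3"
    by algebra
  also have "\<dots> = 0" using assms om_cube om2 by simp
  finally show ?thesis by simp
qed

lemma coprime_linear_comb:
  fixes x y :: "'a::field_gcd poly"
  assumes "coprime x y" "a * d - b * c \<noteq> 0"
  shows "coprime (smult a x + smult b y) (smult c x + smult d y)"
proof (rule coprimeI)
  fix e assume e: "e dvd smult a x + smult b y" "e dvd smult c x + smult d y"
  have "smult (a * d - b * c) x = smult d (smult a x + smult b y) - smult b (smult c x + smult d y)"
    "smult (a * d - b * c) y = smult a (smult c x + smult d y) - smult c (smult a x + smult b y)"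
    by (simp_all add: smult_add_right smult_diff_left algebra_simps)
  hence "e dvd smult (a * d - b * c) x" "e dvd smult (a * d - b * c) y"
    using e by (simp_all add: dvd_diff dvd_smult del: smult_diff_left)
  hence "e dvd x" "e dvd y" using assms(2) by (simp_all add: dvd_smult_iff)
  thus "is_unit e" using assms(1) by (meson coprime_common_divisor)
qed

lemma coprime_rp:
  assumes "coprime x y"
  shows "coprime (rp x) (rp y)"
proof (rule coprimeI)
  fix e assume e: "e dvd rp x" "e dvd rp y"
  obtain u v where "u * x + v * y = 1" using assms by (metis bezout_coefficients_fst_snd coprime_iff_gcd_eq_1)
  hence "rp u * rp x + rp v * rp y = 1" by (metis rp_hom(1,2,6))
  thus "is_unit e" using e by (metis dvd_add dvd_mult)
qed

text \<open>A constant polynomial in place of scalar multiplication, so that \<open>algebra\<close>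
  can use the relation \<open>W_eq\<close>.\<close>

abbreviation W :: "eis poly" where "W \<equiv> [:om:]"

lemma W_eq: "W\<^sup>2 + W + 1 = 0"
  by (simp add: power2_eq_square one_pCons eis_eq_iff)

text \<open>
  Together with its conjugate and x + y, this is the factorisation of x^3 + y^3 into linear forms over K;
  the signs are such that the three factors add up to 0.
\<close>

definition lf :: "rat poly \<Rightarrow> rat poly \<Rightarrow> eis poly" where
  "lf x y = W * rp x + W\<^sup>2 * rp y"

lemma lf_props:
  shows "cjp (lf x y) = W\<^sup>2 * rp x + W * rp y"
    and "lf x y + cjp (lf x y) = - rp (x + y)"
    and "lf x y * (cjp (lf x y) * rp (x + y)) = rp (x ^ 3 + y ^ 3)"
proof -
  have "cjp W = W\<^sup>2" by (simp add: cj_om power2_eq_square)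
  moreover have "(W\<^sup>2)\<^sup>2 = W" using W_eq by algebra
  ultimately show c: "cjp (lf x y) = W\<^sup>2 * rp x + W * rp y"
    by (simp add: lf_def del: mult_pCons_left)
  show "lf x y + cjp (lf x y) = - rp (x + y)"
    "lf x y * (cjp (lf x y) * rp (x + y)) = rp (x ^ 3 + y ^ 3)"
    unfolding c unfolding lf_def rp_hom using W_eq by algebra+
qed

lemma coprime_lf:
  assumes "coprime x y"
  shows "coprime (lf x y) (cjp (lf x y))" "coprime (lf x y) (rp (x + y))"
proof -
  have *: "lf x y = smult om (rp x) + smult (om\<^sup>2) (rp y)"
    "cjp (lf x y) = smult (om\<^sup>2) (rp x) + smult om (rp y)"
    "rp (x + y) = smult 1 (rp x) + smult 1 (rp y)"
    unfolding lf_props(1) unfolding lf_def by (simp_all add: power2_eq_square)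
  show "coprime (lf x y) (cjp (lf x y))" "coprime (lf x y) (rp (x + y))"
    unfolding *(2,3) unfolding *(1) by (rule coprime_linear_comb[OF coprime_rp[OF assms]];
        simp add: eis_eq_iff power2_eq_square)+
qed

lemma rho_1_iff:
  assumes "prim P x y z" "r \<in> kroots"
  shows "rho r P = 1 \<longleftrightarrow> poly (rp (x + y)) r = 0"
proof -
  have "poly (rp (x + y)) r = (1 - rho r P) * poly (rp y) r"
    using rho_prim[OF assms] by (simp add: algebra_simps)
  thus ?thesis using prim_roots(2)[OF assms] by auto
qed

text \<open>Here T - \<open>r3\<close> divides \<open>lf x y\<close>, its conjugate divides the
  conjugate form, and what remains of \<open>lf x y\<close> is a constant times a cube. At
  \<open>r2\<close>, where x + y vanishes, the two forms are opposite; their norms compare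
  \<open>nrm (r2 - r3) = 4\<close> with \<open>nrm (r2 - cj r3) = 7\<close> up to cubes, but 7/4 is
  not a cube.\<close>

lemma no_rho_om:
  assumes "rho r1 P = 1" "rho r2 P = 1" "rho r3 P = om"
  shows False
proof -
  obtain x y z where p: "prim P x y z" using prim_exists by blast
  hence cop: "coprime x y" and h: "hc P x y z" by (auto simp: prim_def)
  have "P \<noteq> 0"
  proof
    assume "P = 0"
    with assms(3) rho_0[of r3] show False by (simp add: kroots_def eis_eq_iff)
  qed
  hence z: "z \<noteq> 0" using hc_0_iff[OF h] by simp
  have rs: "r1 \<in> kroots" "r2 \<in> kroots" "r3 \<in> kroots" by (auto simp: kroots_def)
  have "Q1 dvd x + y" "Q2 dvd x + y"
    using assms(1,2) rho_1_iff[OF p] rs by (simp_all add: Q_dvd_iff)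
  hence "Q1 * Q2 dvd x + y" using Q_coprime(1) by (rule divides_mult)
  then obtain l where l: "x + y = Q1 * Q2 * l" by (auto elim: dvdE)
  define a where "a = lf x y"
  have "poly a r3 = om * poly (rp x) r3 + om\<^sup>2 * poly (rp y) r3"
    by (simp add: a_def lf_def power2_eq_square algebra_simps)
  also have "\<dots> = 0" using rho_prim[OF p rs(3)] assms(3) by (simp add: power2_eq_square)
  finally obtain b where b: "a = [:- r3, 1:] * b" by (auto simp: poly_eq_0_iff_dvd elim: dvdE)
  have cb: "cjp a = [:- cj r3, 1:] * cjp b" unfolding b by (simp del: mult_pCons_left)
  have q3: "[:- r3, 1:] * [:- cj r3, 1:] = rp Q3"
    by (simp add: Q3_def eis_eq_iff)
  have "rp (Q1 * Q2 * Q3) * (b * (cjp b * rp l)) = a * (cjp a * rp (x + y))"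
    unfolding b cb l by (simp add: q3[symmetric] ac_simps del: mult_pCons_left mult_pCons_right)
  also have "\<dots> = rp (Q1 * Q2 * Q3) * smult 63 (rp z ^ 3)"
    unfolding a_def lf_props(3) hc_curve[OF h] by (simp add: kp_def)
  finally have "rp (Q1 * Q2 * Q3) * (b * (cjp b * rp l)) = rp (Q1 * Q2 * Q3) * smult 63 (rp z ^ 3)" .
  moreover have "rp (Q1 * Q2 * Q3) \<noteq> 0" unfolding rp_eq_0_iff by simp
  ultimately have prod: "b * (cjp b * rp l) = smult 63 (rp z ^ 3)" by (metis mult_left_cancel)
  have "coprime b (cjp b * rp l)"
  proof -
    have "b dvd a" "cjp b dvd cjp a" unfolding cb unfolding b by (rule dvd_triv_right)+
    moreover have "rp l dvd rp (x + y)" unfolding l by simp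
    ultimately show ?thesis using coprime_lf[OF cop, folded a_def]
      by (meson coprime_divisors coprime_mult_right_iff)
  qed
  from coprime_mult_eq_cube[OF this prod] z obtain c g where g: "b = smult c (g ^ 3)" "c \<noteq> 0"
    by (metis rp_eq_0_iff zero_neq_numeral)
  have r2: "poly (rp (x + y)) r2 = 0" using assms(2) rho_1_iff[OF p] rs by simp
  have "poly a r2 + poly (cjp a) r2 = 0"
    using arg_cong[OF lf_props(2)[of x y], of "\<lambda>q. poly q r2", folded a_def] r2
    by (simp del: rp_hom(1))
  hence e: "poly a r2 = - poly (cjp a) r2" by (simp add: eq_neg_iff_add_eq_0)
  have "poly a r2 = (r2 - r3) * c * poly g r2 ^ 3"
    unfolding b g by (simp add: algebra_simps)
  moreover have "poly (cjp a) r2 = (r2 - cj r3) * cj c * poly (cjp g) r2 ^ 3"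
    unfolding cb unfolding g by (simp add: algebra_simps)
  moreover have "nrm (r2 - r3) = 4" "nrm (r2 - cj r3) = 7" by (simp_all add: nrm_def)
  ultimately have "4 * nrm c * nrm (poly g r2) ^ 3 = 7 * nrm c * nrm (poly (cjp g) r2) ^ 3"
    using arg_cong[OF e, of nrm] by simp
  hence "of_int (7 * 1) * nrm (poly (cjp g) r2) ^ 3 = of_int 4 * nrm (poly g r2) ^ 3"
    using g(2) by simp
  hence "nrm (poly (cjp g) r2) = 0" by (rule seven_not_cube) simp_all
  \<comment> \<open>The only way out is that both values are zero, which makes \<open>r2\<close> a
    common root of coprime forms.\<close>
  hence "poly (cjp a) r2 = 0" unfolding cb g by simp
  moreover from this e have "poly a r2 = 0" by simp
  ultimately have "[:- r2, 1:] dvd a" "[:- r2, 1:] dvd cjp a" by (simp_all add: poly_eq_0_iff_dvd)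
  hence "is_unit [:- r2, 1:]" using coprime_lf(1)[OF cop] unfolding a_def by (meson coprime_common_divisor)
  thus False by (simp add: is_unit_iff_degree)
qed

lemma rho_third:
  assumes "rho r1 P = 1" "rho r2 P = 1"
  shows "rho r3 P = 1"
proof -
  have rs: "r1 \<in> kroots" "r2 \<in> kroots" "r3 \<in> kroots" by (auto simp: kroots_def)
  have "rho r3 P \<noteq> om" using no_rho_om assms by blast
  moreover have "rho r3 P \<noteq> om\<^sup>2"
  proof
    assume "rho r3 P = om\<^sup>2"
    hence "rho r3 (- P) = om" using rs rho_uminus
      by (metis om_cube inverse_unique mult.commute power2_eq_square power3_eq_cube mult.assoc)
    moreover have "rho r1 (- P) = 1" "rho r2 (- P) = 1" using rs assms rho_uminus by simp_all
    ultimately show False using no_rho_om by blast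
  qed
  ultimately show ?thesis using eis_cube_root_1[OF rho_cube[OF rs(3)]] by blast
qed

text \<open>Modulo cubes c equals \<open>cj c\<close>, so \<open>nrm c = c * cj c\<close> equals
  \<open>c^2\<close>, and its square equals \<open>c^4\<close>, that is c.\<close>

lemma cube_ratio_rational_times_cube:
  fixes c d :: eis
  assumes "c = cj c * d ^ 3" "c \<noteq> 0"
  shows "c = of_rat ((nrm c)\<^sup>2) * (d\<^sup>2 / c) ^ 3"
proof -
  have "of_rat ((nrm c)\<^sup>2) * (d\<^sup>2 / c) ^ 3 = (c * cj c)\<^sup>2 * d ^ 6 / c ^ 3"
    by (simp add: mult_cj of_rat_power power_divide flip: power_mult)
  also have "\<dots> = (cj c * d ^ 3)\<^sup>2 / c"
    using assms(2) by (simp add: field_simps power2_eq_square power3_eq_cube eval_nat_numeral)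
  also have "\<dots> = c" using assms by (simp add: power2_eq_square flip: assms(1))
  finally show ?thesis by simp
qed

text \<open>
  The parametrisation comes from comparing coefficients in w x + w^2 y = c (w s + w^2 t)^3.
\<close>

lemma rho_1_cubic_param:
  assumes p: "prim P x y z" and "P \<noteq> 0" and rho: "rho r1 P = 1" "rho r2 P = 1" "rho r3 P = 1"
  obtains c s t where "c \<noteq> 0" "x = smult c (3 * s\<^sup>2 * t - s ^ 3 - t ^ 3)" "y = smult c (3 * s * t\<^sup>2 - s ^ 3 - t ^ 3)"
proof -
  have cop: "coprime x y" and h: "hc P x y z" using p by (auto simp: prim_def)
  have z: "z \<noteq> 0" using hc_0_iff[OF h] \<open>P \<noteq> 0\<close> by simp
  have rs: "r1 \<in> kroots" "r2 \<in> kroots" "r3 \<in> kroots" by (auto simp: kroots_def)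
  have "Q1 dvd x + y" "Q2 dvd x + y" "Q3 dvd x + y"
    using rho rho_1_iff[OF p] rs by (simp_all add: Q_dvd_iff)
  hence "Q1 * Q2 * Q3 dvd x + y" using Q_coprime by (simp add: divides_mult)
  then obtain l where l: "x + y = Q1 * Q2 * Q3 * l" by (auto elim: dvdE)
  define a where "a = lf x y"
  \<comment> \<open>All of \<open>Q1 * Q2 * Q3\<close> cancels against x + y, so \<open>a\<close> is
    a constant times a cube; the rest of the work makes this constant rational.\<close>
  have "rp (Q1 * Q2 * Q3) * (a * (cjp a * rp l)) = a * (cjp a * rp (x + y))"
    unfolding l by (simp add: ac_simps)
  also have "\<dots> = rp (Q1 * Q2 * Q3) * smult 63 (rp z ^ 3)"
    unfolding a_def lf_props(3) hc_curve[OF h] by (simp add: kp_def)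
  finally have "rp (Q1 * Q2 * Q3) * (a * (cjp a * rp l)) = rp (Q1 * Q2 * Q3) * smult 63 (rp z ^ 3)" .
  moreover have "rp (Q1 * Q2 * Q3) \<noteq> 0" unfolding rp_eq_0_iff by simp
  ultimately have prod: "a * (cjp a * rp l) = smult 63 (rp z ^ 3)" by (metis mult_left_cancel)
  have "coprime a (cjp a * rp l)"
  proof -
    have "rp l dvd rp (x + y)" unfolding l by simp
    thus ?thesis using coprime_lf[OF cop, folded a_def]
      by (meson coprime_divisors coprime_mult_right_iff dvd_refl)
  qed
  from coprime_mult_eq_cube[OF this prod] z obtain c g where g: "a = smult c (g ^ 3)" "c \<noteq> 0"
    by (metis rp_eq_0_iff zero_neq_numeral)
  have ca: "cjp a = smult (cj c) (cjp g ^ 3)" unfolding g by simp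
  \<comment> \<open>Where x + y vanishes, \<open>a\<close> and its conjugate are opposite, and this
    exhibits \<open>c / cj c\<close> as a cube.\<close>
  have r1: "poly (rp (x + y)) r1 = 0" using rho rho_1_iff[OF p] rs by simp
  have "poly a r1 + poly (cjp a) r1 = 0"
    using arg_cong[OF lf_props(2)[of x y], of "\<lambda>q. poly q r1", folded a_def] r1
    by (simp del: rp_hom(1))
  hence e: "c * poly g r1 ^ 3 = - (cj c * poly (cjp g) r1 ^ 3)"
    unfolding ca unfolding g by (simp add: eq_neg_iff_add_eq_0)
  have gnz: "poly g r1 \<noteq> 0"
  proof
    assume 0: "poly g r1 = 0"
    hence "poly (cjp g) r1 = 0" using e g(2) by simp
    with 0 have "poly a r1 = 0" "poly (cjp a) r1 = 0" unfolding ca unfolding g by simp_all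
    hence "[:- r1, 1:] dvd a" "[:- r1, 1:] dvd cjp a" by (simp_all add: poly_eq_0_iff_dvd)
    hence "is_unit [:- r1, 1:]" using coprime_lf(1)[OF cop] unfolding a_def by (meson coprime_common_divisor)
    thus False by (simp add: is_unit_iff_degree)
  qed
  define d where "d = - poly (cjp g) r1 / poly g r1"
  have "c = cj c * d ^ 3"
    using e gnz by (simp add: d_def power_divide field_simps)
  from cube_ratio_rational_times_cube[OF this g(2)]
  have c: "c = of_rat ((nrm c)\<^sup>2) * (d\<^sup>2 / c) ^ 3" .
  define q where "q = (nrm c)\<^sup>2"
  define G where "G = smult (d\<^sup>2 / c) g"
  have aG: "a = smult (of_rat q) (G ^ 3)"
    unfolding G_def g(1) q_def by (subst (1) c) (simp add: smult_power)
  obtain m n where mn: "G = rp m + smult om (rp n)" by (rule eis_poly_decompose)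
  \<comment> \<open>Change from the basis 1, w of K to w, w^2, the shape of
    \<open>lf\<close>.\<close>
  define s t where "s = n - m" and "t = - m"
  have G: "G = lf s t"
    unfolding mn lf_def s_def t_def
    by (simp add: power2_eq_square smult_diff_right om2[unfolded power2_eq_square] smult_diff_left smult_minus_left)
  define C :: "eis poly" where "C = [:of_rat q:]"
  have A: "a = C * (W * rp s + W\<^sup>2 * rp t) ^ 3" unfolding aG G C_def lf_def by simp
  have cA: "cjp a = C * (W\<^sup>2 * rp s + W * rp t) ^ 3"
    unfolding aG G C_def lf_props(1)[symmetric] by simp
  have W1: "1 - W \<noteq> 0" by (simp add: one_pCons eis_eq_iff)
  have "(1 - W) * rp y = W * a - cjp a" unfolding a_def lf_props(1) unfolding lf_def using W_eq by algebra
  also have "\<dots> = (1 - W) * (C * (3 * rp s * rp t ^ 2 - rp s ^ 3 - rp t ^ 3))"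
    unfolding cA unfolding A using W_eq by algebra
  finally have y: "rp y = C * (3 * rp s * rp t ^ 2 - rp s ^ 3 - rp t ^ 3)" using W1 by (metis mult_left_cancel)
  have "(1 - W) * rp x = W * cjp a - a" unfolding a_def lf_props(1) unfolding lf_def using W_eq by algebra
  also have "\<dots> = (1 - W) * (C * (3 * rp s ^ 2 * rp t - rp s ^ 3 - rp t ^ 3))"
    unfolding cA unfolding A using W_eq by algebra
  finally have x: "rp x = C * (3 * rp s ^ 2 * rp t - rp s ^ 3 - rp t ^ 3)" using W1 by (metis mult_left_cancel)
  have "rp x = rp (smult q (3 * s\<^sup>2 * t - s ^ 3 - t ^ 3))" "rp y = rp (smult q (3 * s * t\<^sup>2 - s ^ 3 - t ^ 3))"
    unfolding x y C_def by simp_all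
  moreover have "q \<noteq> 0" using g(2) by (simp add: q_def)
  ultimately show ?thesis using that by (metis rp_eq_iff)
qed

section \<open>The 3-isogenous curve\<close>

definition bad_part :: "rat poly \<Rightarrow> rat poly" where
  "bad_part X = (if Q1 dvd X then Q1 else 1) * (if Q2 dvd X then Q2 else 1) * (if Q3 dvd X then Q3 else 1)"

lemma bad_part_dvd: "bad_part X dvd X"
  using Q_coprime by (auto simp: bad_part_def divides_mult)

text \<open>Each of \<open>Q1\<close>, \<open>Q2\<close>, \<open>Q3\<close> divides exactly one of X
  and Y. Dividing out the bad parts leaves coprime cofactors whose product is a constant times a
  cube.\<close>

lemma coprime_factor_form:
  assumes "coprime X Y" "X * Y = kp * w ^ 3" "w \<noteq> 0"
  obtains c g where "c \<noteq> 0" "X = smult c (bad_part X * g ^ 3)"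
proof -
  have "bad_part X * bad_part Y = Q1 * Q2 * Q3"
  proof -
    have one: "(if q dvd X then q else 1) * (if q dvd Y then q else 1) = q" if "prime_elem q" "q dvd kp" for q
    proof -
      have "q dvd X * Y" using that(2) assms(2) by simp
      hence "q dvd X \<or> q dvd Y" using that(1) prime_elem_dvd_mult_iff by blast
      moreover have "\<not> (q dvd X \<and> q dvd Y)"
        using assms(1) that(1) by (meson coprime_common_divisor prime_elem_not_unit)
      ultimately show ?thesis by auto
    qed
    have "Q1 dvd kp" "Q2 dvd kp" "Q3 dvd kp" by (simp_all add: Q_dvd_iff)
    note one = one[OF Q_prime(1) this(1)] one[OF Q_prime(2) this(2)] one[OF Q_prime(3) this(3)]
    have "bad_part X * bad_part Y
        = ((if Q1 dvd X then Q1 else 1) * (if Q1 dvd Y then Q1 else 1))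
          * ((if Q2 dvd X then Q2 else 1) * (if Q2 dvd Y then Q2 else 1))
          * ((if Q3 dvd X then Q3 else 1) * (if Q3 dvd Y then Q3 else 1))"
      by (simp only: bad_part_def mult_ac)
    thus ?thesis unfolding one .
  qed
  moreover obtain X' Y' where XY: "X = bad_part X * X'" "Y = bad_part Y * Y'"
    using bad_part_dvd by (meson dvdE)
  ultimately have "(Q1 * Q2 * Q3) * (X' * Y') = (Q1 * Q2 * Q3) * smult 63 (w ^ 3)"
    using assms(2) by (simp add: kp_def) (metis (no_types, lifting) mult.assoc mult.left_commute)
  hence "X' * Y' = smult 63 (w ^ 3)" by (subst (asm) mult_left_cancel) simp_all
  moreover have "coprime X' Y'" using assms(1) XY by (metis coprime_mult_left_iff coprime_mult_right_iff)
  ultimately obtain c g where "X' = smult c (g ^ 3)" "c \<noteq> 0"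
    using coprime_mult_eq_cube assms(3) by (metis zero_neq_numeral)
  thus ?thesis using that[of c g] XY(1) by (metis mult_smult_right)
qed

lemma rat_square_eq_cube:
  fixes x s :: rat
  assumes "x\<^sup>2 = s ^ 3"
  obtains t where "x = t ^ 3"
proof (cases "x = 0")
  case False
  hence "s \<noteq> 0" using assms by auto
  hence "x = (x / s) ^ 3" using assms by (simp add: field_simps power2_eq_square power3_eq_cube)
  thus ?thesis by (rule that)
qed (use that[of 0] in simp)

text \<open>At \<open>r1\<close>, where A vanishes, \<open>Q2\<close> and \<open>Q3\<close> take
  values of the same norm 28/9, so norms turn B = - C into the statement that (c2 / c3)^2, hence c2
  / c3, is a cube. At \<open>r2\<close> the common norm is 28 and c1 / c3 is a cube. Then c1 c2 c3
  is a cube, and 63 would be one too.\<close>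

lemma no_mixed_distribution:
  assumes "A = smult c1 (Q1 * a ^ 3)" "B = smult c2 (Q2 * b ^ 3)" "C = smult c3 (Q3 * c ^ 3)"
    and s: "A + B + C = 0" and cop: "coprime A B" "coprime A C" "coprime B C"
    and prod: "A * B * C = kp * w ^ 3" and w: "w \<noteq> 0"
  shows False
proof -
  have nz: "c1 \<noteq> 0" "c2 \<noteq> 0" "c3 \<noteq> 0" using assms(1-3) prod w by auto
  have Qd: "Q1 dvd A" "Q2 dvd B" by (simp_all add: assms(1,2) dvd_smult)
  hence "poly (rp B) r1 \<noteq> 0" "poly (rp C) r1 \<noteq> 0" "poly (rp A) r2 \<noteq> 0" "poly (rp C) r2 \<noteq> 0"
    using cop coprime_roots[of r1 A B] coprime_roots[of r1 A C] coprime_roots[of r2 B A] coprime_roots[of r2 B C]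
    by (simp_all add: Q_dvd_iff kroots_def coprime_commute)
  hence n: "poly (rp b) r1 \<noteq> 0" "poly (rp c) r1 \<noteq> 0" "poly (rp a) r2 \<noteq> 0" "poly (rp c) r2 \<noteq> 0"
    by (auto simp: assms(1-3))
  have S: "poly (rp A) r + poly (rp B) r + poly (rp C) r = 0" for r
    using arg_cong[OF s, of "\<lambda>p. poly (rp p) r"] by simp
  have ratio: "\<exists>t. u / v = t ^ 3" if "u\<^sup>2 * \<beta> ^ 3 = v\<^sup>2 * \<gamma> ^ 3" "v \<noteq> 0" "\<beta> \<noteq> 0" for u v \<beta> \<gamma> :: rat
  proof -
    have "(u / v)\<^sup>2 = (\<gamma> / \<beta>) ^ 3" using that by (simp add: field_simps)
    thus ?thesis by (rule rat_square_eq_cube) blast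
  qed
  have q: "nrm (poly (rp Q2) r1) = 28 / 9" "nrm (poly (rp Q3) r1) = 28 / 9"
    "nrm (poly (rp Q1) r2) = 28" "nrm (poly (rp Q3) r2) = 28"
    by (simp_all add: Q_defs nrm_def power2_eq_square)
  have "of_rat c2 * poly (rp Q2) r1 * poly (rp b) r1 ^ 3 = - (of_rat c3 * poly (rp Q3) r1 * poly (rp c) r1 ^ 3)"
    using S[of r1] by (simp add: assms(1-3) eq_neg_iff_add_eq_0 mult.assoc)
  from arg_cong[OF this, of nrm] have "c2\<^sup>2 * nrm (poly (rp b) r1) ^ 3 = c3\<^sup>2 * nrm (poly (rp c) r1) ^ 3"
    by (simp add: q)
  from ratio[OF this nz(3)] n(1) obtain t where t: "c2 / c3 = t ^ 3" by (metis nrm_eq_0_iff)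
  have "of_rat c1 * poly (rp Q1) r2 * poly (rp a) r2 ^ 3 = - (of_rat c3 * poly (rp Q3) r2 * poly (rp c) r2 ^ 3)"
    using S[of r2] by (simp add: assms(1-3) eq_neg_iff_add_eq_0 mult.assoc)
  from arg_cong[OF this, of nrm] have "c1\<^sup>2 * nrm (poly (rp a) r2) ^ 3 = c3\<^sup>2 * nrm (poly (rp c) r2) ^ 3"
    by (simp add: q)
  from ratio[OF this nz(3)] n(3) obtain u where u: "c1 / c3 = u ^ 3" by (metis nrm_eq_0_iff)
  have "(Q1 * Q2 * Q3) * smult 63 (w ^ 3) = A * B * C" by (simp add: prod kp_def)
  also have "\<dots> = (Q1 * Q2 * Q3) * smult (c1 * c2 * c3) ((a * b * c) ^ 3)"
    by (simp add: assms(1-3) power_mult_distrib ac_simps)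
  also have "c1 * c2 * c3 = (c3 * t * u) ^ 3"
    using t u nz by (simp add: field_simps power3_eq_cube)
  finally have "smult 63 (w ^ 3) = smult ((c3 * t * u) ^ 3) ((a * b * c) ^ 3)"
    by (subst (asm) mult_left_cancel) simp_all
  also have "\<dots> = smult (c3 * t * u) (a * b * c) ^ 3" by (rule smult_power[symmetric])
  finally have "63 * lead_coeff w ^ 3 = lead_coeff (smult (c3 * t * u) (a * b * c)) ^ 3"
    by (metis lead_coeff_power lead_coeff_smult)
  hence "of_int (7 * 9) * lead_coeff w ^ 3 = of_int 1 * lead_coeff (smult (c3 * t * u) (a * b * c)) ^ 3"
    by simp
  from seven_not_cube[OF this] w show False by simp
qed

text \<open>At \<open>r1\<close>, where C vanishes, A and B are opposite, so c1 / c2 is a cube in K,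
  therefore in Q, and can be absorbed into \<open>a\<close>.\<close>

lemma common_ratio_cubes:
  assumes "A = smult c1 (a ^ 3)" "B = smult c2 (b ^ 3)" "c1 \<noteq> 0" "c2 \<noteq> 0"
    and "A + B + C = 0" "Q1 dvd C" "coprime A C"
  obtains u a where "u \<noteq> 0" "A = smult u (a ^ 3)" "B = smult u (b ^ 3)"
proof -
  have C: "poly (rp C) r1 = 0" using assms(6) by (simp add: Q_dvd_iff)
  hence "poly (rp A) r1 \<noteq> 0"
    using coprime_roots[of r1 C A] assms(7) by (simp add: kroots_def coprime_commute)
  hence a: "poly (rp a) r1 \<noteq> 0" by (auto simp: assms(1))
  have "poly (rp A) r1 + poly (rp B) r1 = 0"
    using arg_cong[OF assms(5), of "\<lambda>p. poly (rp p) r1"] C by simp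
  hence "of_rat c1 * poly (rp a) r1 ^ 3 = - (of_rat c2 * poly (rp b) r1 ^ 3)"
    by (simp add: assms(1,2) eq_neg_iff_add_eq_0)
  hence "of_rat (c1 / c2) = (- poly (rp b) r1 / poly (rp a) r1) ^ 3"
    using a assms(4) by (simp add: of_rat_divide field_simps)
  then obtain t where t: "c1 / c2 = t ^ 3" by (rule of_rat_cube_eis)
  hence "A = smult c2 (smult t a ^ 3)" using assms(1,4) by (simp add: smult_power field_simps)
  thus ?thesis using that[of c2 "smult t a"] assms by blast
qed

lemma degree_bad_part:
  "degree (bad_part X) = 2 * (of_bool (Q1 dvd X) + of_bool (Q2 dvd X) + of_bool (Q3 dvd X))"
  by (simp add: bad_part_def degree_mult_eq)

lemma degree_eq_of_sum_0:
  fixes A B C :: "'a::comm_ring_1 poly"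
  assumes "A + B + C = 0"
  shows "degree A = degree B \<or> degree A = degree C \<or> degree B = degree C"
proof (rule ccontr)
  assume n: "\<not> ?thesis"
  have C: "C = - (A + B)" using assms by (metis add_eq_0_iff)
  have d: "degree C = degree (A + B)" unfolding C by (rule degree_minus)
  consider "degree A < degree B" | "degree B < degree A" using n by linarith
  thus False using n d degree_add_eq_right[of A B] degree_add_eq_left[of B A] by cases simp_all
qed

text \<open>A term divisible by n of \<open>Q1\<close>, \<open>Q2\<close>, \<open>Q3\<close> has
  degree 2n modulo 3, and two of three terms with sum 0 have equal degree. Hence the three counts,
  with sum 3, are 3, 0, 0 in some order or 1, 1, 1. \<open>no_mixed_distribution\<close> excludes
  the latter; in the former the two terms without bad part are the required pair.\<close>

lemma sum_zero_product_cubes: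
  assumes s: "A + B + C = 0" and cop: "coprime A B" and prod: "A * B * C = kp * w ^ 3" and w: "w \<noteq> 0"
  shows "\<exists>u a b. u \<noteq> 0 \<and> (A = smult u (a ^ 3) \<and> B = smult u (b ^ 3) \<or>
    B = smult u (a ^ 3) \<and> C = smult u (b ^ 3) \<or> C = smult u (a ^ 3) \<and> A = smult u (b ^ 3))"
proof -
  have C: "C = - (A + B)" using s by (metis add_eq_0_iff)
  have cop': "coprime A C" "coprime B C"
  proof -
    have "coprime A (A + B)" "coprime B (A + B)"
      using cop by (meson coprimeI coprime_common_divisor dvd_add_left_iff dvd_add_right_iff)+
    thus "coprime A C" "coprime B C" unfolding C coprime_minus_right_iff .
  qed
  have nz: "A \<noteq> 0" "B \<noteq> 0" "C \<noteq> 0" using prod w by auto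
  obtain c1 a where a: "c1 \<noteq> 0" "A = smult c1 (bad_part A * a ^ 3)"
    using coprime_factor_form[of A "B * C" w] cop cop' prod w by (auto simp: ac_simps)
  obtain c2 b where b: "c2 \<noteq> 0" "B = smult c2 (bad_part B * b ^ 3)"
    using coprime_factor_form[of B "A * C" w] cop cop' prod w by (auto simp: ac_simps coprime_commute)
  obtain c3 c where c: "c3 \<noteq> 0" "C = smult c3 (bad_part C * c ^ 3)"
    using coprime_factor_form[of C "A * B" w] cop cop' prod w by (auto simp: ac_simps coprime_commute)
  have one: "q dvd A \<and> \<not> q dvd B \<and> \<not> q dvd C \<or> \<not> q dvd A \<and> q dvd B \<and> \<not> q dvd C
      \<or> \<not> q dvd A \<and> \<not> q dvd B \<and> q dvd C" if "prime_elem q" "q dvd kp" for q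
  proof -
    have "q dvd A * B * C" using prod that(2) by simp
    hence "q dvd A \<or> q dvd B \<or> q dvd C" using that(1) by (simp add: prime_elem_dvd_mult_iff)
    moreover have "\<not> is_unit q" using that(1) by (rule prime_elem_not_unit)
    ultimately show ?thesis using cop cop' coprime_common_divisor by metis
  qed
  have "Q1 dvd kp" "Q2 dvd kp" "Q3 dvd kp" by (simp_all add: Q_dvd_iff)
  note one = one[OF Q_prime(1) this(1)] one[OF Q_prime(2) this(2)] one[OF Q_prime(3) this(3)]
  define n :: "rat poly \<Rightarrow> nat" where
    "n X = of_bool (Q1 dvd X) + of_bool (Q2 dvd X) + of_bool (Q3 dvd X)" for X
  have deg: "degree X = 2 * n X + 3 * degree g" if "X = smult d (bad_part X * g ^ 3)" "X \<noteq> 0" for X g d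
  proof -
    have "d \<noteq> 0" "g \<noteq> 0" using that by (metis smult_0_left, metis mult_zero_right power_0_left smult_0_right zero_neq_numeral)
    moreover have "bad_part X \<noteq> 0" by (simp add: bad_part_def)
    moreover have "degree X = degree (smult d (bad_part X * g ^ 3))" using that(1) by simp
    ultimately have "degree X = degree (bad_part X) + 3 * degree g"
      by (simp add: degree_mult_eq degree_power_eq)
    thus ?thesis by (simp add: degree_bad_part n_def)
  qed
  have "n A + n B + n C = 3" using one by (auto simp: n_def)
  moreover have "2 * n A + 3 * degree a = 2 * n B + 3 * degree b \<or> 2 * n A + 3 * degree a = 2 * n C + 3 * degree c
      \<or> 2 * n B + 3 * degree b = 2 * n C + 3 * degree c"
    using degree_eq_of_sum_0[OF s] deg[OF a(2) nz(1)] deg[OF b(2) nz(2)] deg[OF c(2) nz(3)] by simp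
  moreover have "i = 3 \<or> j = 3 \<or> l = 3 \<or> i = 1 \<and> j = 1 \<and> l = 1"
    if "i + j + l = 3" "2 * i + 3 * d = 2 * j + 3 * e \<or> 2 * i + 3 * d = 2 * l + 3 * f \<or> 2 * j + 3 * e = 2 * l + 3 * f"
    for i j l d e f :: nat
  proof -
    have "i mod 3 = j mod 3 \<or> i mod 3 = l mod 3 \<or> j mod 3 = l mod 3"
    proof -
      \<comment> \<open>As 4 is 1 modulo 3, doubling the degree recovers the count.\<close>
      have m: "(2 * (2 * i + 3 * d)) mod 3 = i mod 3" for i d :: nat
      proof -
        have "2 * (2 * i + 3 * d) = i + 3 * (i + 2 * d)" by simp
        thus ?thesis by (simp only: mod_mult_self2)
      qed
      show ?thesis using that(2) m[of i d] m[of j e] m[of l f] by metis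
    qed
    moreover from that(1) have l: "l = 3 - i - j" by simp
    moreover have "i \<in> {..3}" "j \<in> {..3}" using that(1) by simp_all
    hence "i = 0 \<or> i = 1 \<or> i = 2 \<or> i = 3" "j = 0 \<or> j = 1 \<or> j = 2 \<or> j = 3"
      by (auto simp: atMost_nat_numeral le_Suc_eq)
    ultimately show ?thesis using that(1) unfolding l by (elim disjE) simp_all
  qed
  ultimately consider "n A = 3" | "n B = 3" | "n C = 3" | "n A = 1" "n B = 1" "n C = 1" by metis
  thus ?thesis
  proof cases
    case 1
    hence d: "Q1 dvd A" "bad_part B = 1" "bad_part C = 1"
      using one by (auto simp: n_def bad_part_def split: if_splits)
    from s have "B + C + A = 0" by (simp add: algebra_simps)
    with common_ratio_cubes[of B c2 b C c3 c A] a b c d cop show ?thesis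
      by (metis coprime_commute mult_1)
  next
    case 2
    hence d: "Q1 dvd B" "bad_part A = 1" "bad_part C = 1"
      using one by (auto simp: n_def bad_part_def split: if_splits)
    from s have "C + A + B = 0" by (simp add: algebra_simps)
    with common_ratio_cubes[of C c3 c A c1 a B] a b c d cop' show ?thesis
      by (metis coprime_commute mult_1)
  next
    case 3
    hence d: "Q1 dvd C" "bad_part A = 1" "bad_part B = 1"
      using one by (auto simp: n_def bad_part_def split: if_splits)
    with common_ratio_cubes[of A c1 a B c2 b C] s a b c d cop' show ?thesis
      by (metis mult_1)
  next
    case 4
    note nm = no_mixed_distribution[OF _ _ _ _ _ _ _ _ w]
    note cops = cop cop' cop[THEN coprime_commute[THEN iffD1]] cop'[THEN coprime_commute[THEN iffD1]]
    from 4 one consider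
      "bad_part A = Q1" "bad_part B = Q2" "bad_part C = Q3" | "bad_part A = Q1" "bad_part B = Q3" "bad_part C = Q2"
      | "bad_part A = Q2" "bad_part B = Q1" "bad_part C = Q3" | "bad_part A = Q2" "bad_part B = Q3" "bad_part C = Q1"
      | "bad_part A = Q3" "bad_part B = Q1" "bad_part C = Q2" | "bad_part A = Q3" "bad_part B = Q2" "bad_part C = Q1"
      by (auto simp: n_def bad_part_def split: if_splits)
    hence False
    proof cases
      case 1
      with a b c show ?thesis using nm[of A c1 a B c2 b C c3 c] s prod cops by simp
    next
      case 2
      with a b c show ?thesis using nm[of A c1 a C c3 c B c2 b] s prod cops by (simp add: ac_simps)
    next
      case 3
      with a b c show ?thesis using nm[of B c2 b A c1 a C c3 c] s prod cops by (simp add: ac_simps)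
    next
      case 4
      with a b c show ?thesis using nm[of C c3 c A c1 a B c2 b] s prod cops by (simp add: ac_simps)
    next
      case 5
      with a b c show ?thesis using nm[of B c2 b C c3 c A c1 a] s prod cops by (simp add: ac_simps)
    next
      case 6
      with a b c show ?thesis using nm[of C c3 c B c2 b A c1 a] s prod cops by (simp add: ac_simps)
    qed
    thus ?thesis ..
  qed
qed

text \<open>The third form is - u (a^3 + b^3), so cancelling cubes makes (a : b : v) a point S of
  the original curve. The isogeny taking S to (s : t), followed by the parametrisation taking (s :
  t) to P, is multiplication by -3.\<close>

lemma triple_of_cubes:
  assumes h: "hc P x y z" and c: "x = smult c (3 * s\<^sup>2 * t - s ^ 3 - t ^ 3)" "y = smult c (3 * s * t\<^sup>2 - s ^ 3 - t ^ 3)"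
    and ab: "s + t = smult u (a ^ 3)" "s - 2 * t = smult u (b ^ 3)" "u \<noteq> 0"
    and w: "(s + t) * (s - 2 * t) * (t - 2 * s) = kp * w ^ 3" "w \<noteq> 0"
  shows "\<exists>S. P = S + S + S"
proof -
  define U where "U = [:u:]"
  have U: "U \<noteq> 0" using ab(3) by (simp add: U_def)
  have A: "s + t = U * a ^ 3" and B: "s - 2 * t = U * b ^ 3" using ab by (simp_all add: U_def)
  have s: "3 * s = U * (2 * a ^ 3 + b ^ 3)" and t: "3 * t = U * (a ^ 3 - b ^ 3)"
    using A B by algebra+
  have k: "kp * w ^ 3 = (a * b) ^ 3 * (- (U ^ 3 * (a ^ 3 + b ^ 3)))"
  proof -
    have "t - 2 * s = - (U * (a ^ 3 + b ^ 3))" using A B by algebra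
    thus ?thesis unfolding w(1)[symmetric] A B by algebra
  qed
  hence "a * b dvd w" using cube_dvd_imp_dvd by (metis dvd_triv_left)
  then obtain w' where w': "w = a * b * w'" by (auto elim: dvdE)
  have nz: "a \<noteq> 0" "b \<noteq> 0" using w(2) w' by auto
  have "(a * b) ^ 3 * (kp * w' ^ 3) = (a * b) ^ 3 * (- (U ^ 3 * (a ^ 3 + b ^ 3)))"
    using k unfolding w' by (simp add: power_mult_distrib ac_simps)
  hence k': "kp * w' ^ 3 = - (U ^ 3 * (a ^ 3 + b ^ 3))" by (rule mult_left_cancel[THEN iffD1, rotated]) (use nz in simp)
  define v where "v = smult (- 1 / u) w'"
  have v: "w' = - (U * v)" using ab(3) by (simp add: v_def U_def)
  have "U ^ 3 * (kp * v ^ 3) = U ^ 3 * (a ^ 3 + b ^ 3)" using k' unfolding v by algebra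
  hence kv: "a ^ 3 + b ^ 3 = kp * v ^ 3" using U by simp
  obtain S where S: "hc S a b v" using hc_ex[OF kv nz(1)] .
  have "addx kp a b v a b v = b * (2 * a ^ 3 + b ^ 3)" "addy kp a b v a b v = - (a * (a ^ 3 + 2 * b ^ 3))"
    using kv unfolding add_defs by algebra+
  moreover have "addz kp a b v a b v = v * (b ^ 3 - a ^ 3)"
    unfolding add_defs by algebra
  ultimately have S2: "hc (S + S) (b * (2 * a ^ 3 + b ^ 3)) (- (a * (a ^ 3 + 2 * b ^ 3))) (v * (b ^ 3 - a ^ 3))"
    using hc_add[OF S S] by simp
  \<comment> \<open>Up to sign and the common factor \<open>b\<close>, \<open>L\<close> and
    \<open>M\<close> are the coordinates of 3S, written as forms in a^3 and b^3.\<close>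
  define M where "M = (b ^ 3) ^ 3 + 6 * a ^ 3 * (b ^ 3)\<^sup>2 + 3 * (a ^ 3)\<^sup>2 * b ^ 3 - (a ^ 3) ^ 3"
  define L where "L = (b ^ 3) ^ 3 - 3 * a ^ 3 * (b ^ 3)\<^sup>2 - 6 * (a ^ 3)\<^sup>2 * b ^ 3 - (a ^ 3) ^ 3"
  have "addx kp (b * (2 * a ^ 3 + b ^ 3)) (- (a * (a ^ 3 + 2 * b ^ 3))) (v * (b ^ 3 - a ^ 3)) a b v = b * L"
    "addy kp (b * (2 * a ^ 3 + b ^ 3)) (- (a * (a ^ 3 + 2 * b ^ 3))) (v * (b ^ 3 - a ^ 3)) a b v = - (b * M)"
    using kv unfolding add_defs L_def M_def by algebra+
  with hc_uminus[OF hc_add[OF S2 S]] obtain e where S3: "hc (- (S + S + S)) (- (b * M)) (b * L) e" by metis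
  define C where "C = [:c:]"
  have x: "x = C * (3 * s\<^sup>2 * t - s ^ 3 - t ^ 3)" and y: "y = C * (3 * s * t\<^sup>2 - s ^ 3 - t ^ 3)"
    using c by (simp_all add: C_def)
  have "27 * x = C * (3 * (3 * s)\<^sup>2 * (3 * t) - (3 * s) ^ 3 - (3 * t) ^ 3)" unfolding x by algebra
  also have "\<dots> = - 3 * (C * U ^ 3 * M)" unfolding s t M_def by algebra
  finally have x27: "27 * x = - 3 * (C * U ^ 3 * M)" .
  have "27 * y = C * (3 * (3 * s) * (3 * t)\<^sup>2 - (3 * s) ^ 3 - (3 * t) ^ 3)" unfolding y by algebra
  also have "\<dots> = 3 * (C * U ^ 3 * L)" unfolding s t L_def by algebra
  finally have y27: "27 * y = 3 * (C * U ^ 3 * L)" .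
  have "27 * (x * (b * L)) = (27 * x) * (b * L)" by (simp add: ac_simps)
  also have "\<dots> = (- (b * M)) * (27 * y)" unfolding x27 y27 by algebra
  also have "\<dots> = 27 * (- (b * M) * y)" by (simp add: ac_simps)
  finally have "x * (b * L) = - (b * M) * y"
    by (rule mult_left_cancel[THEN iffD1, rotated]) simp
  from hc_cross_cube[OF h S3 this] have "P = (- S) + (- S) + (- S)" by (simp add: algebra_simps)
  thus ?thesis by blast
qed

text \<open>In the parametrisation x + y = c A B D and x^2 - x y + y^2 = c^2 N^3. Stripping cubes
  from the curve equation leaves A B D = k w^3 with A + B + D = 0, a point of the isogenous
  curve.\<close>

lemma rho_1_imp_triple:
  assumes "rho r1 P = 1" "rho r2 P = 1"
  shows "\<exists>S. P = S + S + S"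
proof (cases "P = 0")
  case True
  thus ?thesis by (intro exI[of _ 0]) simp
next
  case False
  obtain x y z where p: "prim P x y z" using prim_exists by blast
  hence h: "hc P x y z" and cop: "coprime x y" by (auto simp: prim_def)
  have z: "z \<noteq> 0" using hc_0_iff[OF h] False by simp
  obtain c s t where c: "c \<noteq> 0" "x = smult c (3 * s\<^sup>2 * t - s ^ 3 - t ^ 3)" "y = smult c (3 * s * t\<^sup>2 - s ^ 3 - t ^ 3)"
    using rho_1_cubic_param[OF p False assms rho_third[OF assms]] by metis
  define A B D where "A = s + t" and "B = s - 2 * t" and "D = t - 2 * s"
  have st: "coprime s t"
  proof (rule coprimeI)
    fix e assume "e dvd s" "e dvd t"
    hence "e dvd 3 * s\<^sup>2 * t - s ^ 3 - t ^ 3" "e dvd 3 * s * t\<^sup>2 - s ^ 3 - t ^ 3"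
      by (simp_all add: dvd_diff dvd_mult power3_eq_cube)
    hence "e dvd x" "e dvd y" using c by (simp_all add: dvd_smult)
    thus "is_unit e" using cop by (meson coprime_common_divisor)
  qed
  have "coprime A B"
  proof -
    have "A = smult 1 s + smult 1 t" "B = smult 1 s + smult (- 2) t"
      by (simp_all add: A_def B_def numeral_mult_poly)
    thus ?thesis using coprime_linear_comb[OF st, of 1 "- 2" 1 1] by simp
  qed
  define C where "C = [:c:]"
  have C: "C \<noteq> 0" using c by (simp add: C_def)
  have x: "x = C * (3 * s\<^sup>2 * t - s ^ 3 - t ^ 3)" and y: "y = C * (3 * s * t\<^sup>2 - s ^ 3 - t ^ 3)"
    using c by (simp_all add: C_def)
  define N where "N = s\<^sup>2 - s * t + t\<^sup>2"
  have eq: "kp * z ^ 3 = N ^ 3 * (C ^ 3 * (A * B * D))"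
    unfolding hc_curve[OF h, symmetric] x y A_def B_def D_def N_def by algebra
  hence "N dvd z" using cube_dvd_imp_dvd by (metis dvd_triv_left)
  then obtain z' where z': "z = N * z'" by (auto elim: dvdE)
  have N: "N \<noteq> 0" using z z' by auto
  have "N ^ 3 * (kp * z' ^ 3) = N ^ 3 * (C ^ 3 * (A * B * D))"
    using eq unfolding z' by (simp add: power_mult_distrib ac_simps)
  hence k': "kp * z' ^ 3 = C ^ 3 * (A * B * D)" using N by simp
  define w where "w = smult (1 / c) z'"
  have w: "z' = C * w" using c by (simp add: w_def C_def)
  have "C ^ 3 * (A * B * D) = C ^ 3 * (kp * w ^ 3)"
    unfolding k'[symmetric] w by (simp only: power_mult_distrib ac_simps)
  hence prod: "A * B * D = kp * w ^ 3"
    by (rule mult_left_cancel[THEN iffD1, rotated]) (use C in simp)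
  have w0: "w \<noteq> 0" using z z' w by auto
  have "A + B + D = 0" by (simp add: A_def B_def D_def)
  from sum_zero_product_cubes[OF this \<open>coprime A B\<close> prod w0] obtain u a b where u: "u \<noteq> 0"
    and "A = smult u (a ^ 3) \<and> B = smult u (b ^ 3) \<or>
      B = smult u (a ^ 3) \<and> D = smult u (b ^ 3) \<or> D = smult u (a ^ 3) \<and> A = smult u (b ^ 3)" by blast
  then consider "A = smult u (a ^ 3)" "B = smult u (b ^ 3)" | "B = smult u (a ^ 3)" "D = smult u (b ^ 3)"
    | "D = smult u (a ^ 3)" "A = smult u (b ^ 3)" by blast
  thus ?thesis
  proof cases
    case 1
    with triple_of_cubes[OF h c(2,3) _ _ u _ w0] prod show ?thesis by (simp add: A_def B_def D_def)
  next
    case 2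
    \<comment> \<open>This substitution multiplies \<open>lf s t\<close> by \<open>om\<close>: its
      cube, hence x and y, stays the same while A, B, D are permuted cyclically. The last case uses
      \<open>om^2\<close>.\<close>
    have "3 * (- t)\<^sup>2 * (s - t) - (- t) ^ 3 - (s - t) ^ 3 = 3 * s\<^sup>2 * t - s ^ 3 - t ^ 3"
      "3 * (- t) * (s - t)\<^sup>2 - (- t) ^ 3 - (s - t) ^ 3 = 3 * s * t\<^sup>2 - s ^ 3 - t ^ 3" by algebra+
    note e = this
    have e': "(- t) + (s - t) = B" "(- t) - 2 * (s - t) = D" "(s - t) - 2 * (- t) = A"
      by (simp_all add: A_def B_def D_def algebra_simps)
    show ?thesis
      by (rule triple_of_cubes[OF h, of c "- t" "s - t" u a b w]; (unfold e e')?;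
          (fact c u w0 2 | simp only: prod[symmetric] mult_ac))
  next
    case 3
    have "3 * (t - s)\<^sup>2 * (- s) - (t - s) ^ 3 - (- s) ^ 3 = 3 * s\<^sup>2 * t - s ^ 3 - t ^ 3"
      "3 * (t - s) * (- s)\<^sup>2 - (t - s) ^ 3 - (- s) ^ 3 = 3 * s * t\<^sup>2 - s ^ 3 - t ^ 3" by algebra+
    note e = this
    have e': "(t - s) + (- s) = D" "(t - s) - 2 * (- s) = A" "(- s) - 2 * (t - s) = B"
      by (simp_all add: A_def B_def D_def algebra_simps)
    show ?thesis
      by (rule triple_of_cubes[OF h, of c "t - s" "- s" u a b w]; (unfold e e')?;
          (fact c u w0 3 | simp only: prod[symmetric] mult_ac))
  qed
qed

section \<open>The rank\<close>

text \<open>Built like \<open>csmul\<close>, so that \<open>Rep_sm\<close> reduces to an induction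
  on iterates.\<close>

definition sm :: "int \<Rightarrow> pt \<Rightarrow> pt" where
  "sm n P = (if n \<ge> 0 then ((+) P ^^ nat n) 0 else - ((+) P ^^ nat (- n)) 0)"

lemma sm_0 [simp]: "sm 0 P = 0" and sm_1 [simp]: "sm 1 P = P"
  by (simp_all add: sm_def)

lemma sm_succ: "sm (n + 1) P = sm n P + P"
proof -
  consider "n \<ge> 0" | "n = - 1" | "n < - 1" by linarith
  thus ?thesis
  proof cases
    case 1
    hence "nat (n + 1) = Suc (nat n)" by simp
    thus ?thesis using 1 by (simp add: sm_def add.commute)
  next
    case 3
    hence "nat (- n) = Suc (nat (- (n + 1)))" by simp
    thus ?thesis using 3 by (simp add: sm_def)
  qed (simp add: sm_def)
qed

lemma sm_add: "sm (m + n) P = sm m P + sm n P"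
proof (induction n rule: int_induct[of _ 0])
  case (step1 n)
  thus ?case using sm_succ[of "m + n" P] sm_succ[of n P] by (simp add: ac_simps)
next
  case (step2 n)
  thus ?case using sm_succ[of "m + (n - 1)" P] sm_succ[of "n - 1" P] by (simp add: algebra_simps)
qed simp

lemma sm_uminus: "sm (- n) P = - sm n P"
  using sm_add[of "- n" n P] by (simp add: eq_neg_iff_add_eq_0)

lemma sm_diff: "sm (m - n) P = sm m P - sm n P"
  using sm_add[of m "- n" P] by (simp add: sm_uminus)

lemma sm_add_right: "sm n (P + Q) = sm n P + sm n Q"
proof (induction n rule: int_induct[of _ 0])
  case (step1 n)
  thus ?case unfolding sm_succ by (simp add: ac_simps)
next
  case (step2 n)
  thus ?case using sm_succ[of "n - 1" P] sm_succ[of "n - 1" Q] sm_succ[of "n - 1" "P + Q"]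
    by (simp add: algebra_simps)
qed simp

lemma sm_0_right [simp]: "sm n 0 = 0"
  using sm_add_right[of n 0 0] by simp

lemma sm_mult: "sm (m * n) P = sm m (sm n P)"
proof (induction m rule: int_induct[of _ 0])
  case (step1 m)
  thus ?case by (simp add: sm_succ sm_add algebra_simps)
next
  case (step2 m)
  thus ?case using sm_succ[of "m - 1" "sm n P"] by (simp add: sm_diff algebra_simps)
qed simp

lemma sm_3: "sm 3 P = P + P + P"
  using sm_succ[of 2 P] sm_succ[of 1 P] by simp

lemma Rep_sm: "csmul kT n (Rep_pt P) = Rep_pt (sm n P)"
proof -
  have "(cadd kT (Rep_pt P) ^^ m) None = Rep_pt (((+) P ^^ m) 0)" for m
    by (induction m) (simp_all add: Rep_zero Rep_add)
  thus ?thesis by (simp add: csmul_def sm_def Rep_uminus)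
qed

lemma ht_sm_unit: "n \<in> {- 1, 0, 1} \<Longrightarrow> ht (sm n P) = (if n = 0 then 0 else ht P)"
  using sm_uminus[of 1 P] by (auto simp: ht_eq_0_iff)

section \<open>Descent on three independent points\<close>

definition indep3 :: "pt \<Rightarrow> pt \<Rightarrow> pt \<Rightarrow> bool" where
  "indep3 P Q R \<longleftrightarrow> (\<forall>a b c. sm a P + sm b Q + sm c R = 0 \<longrightarrow> a = 0 \<and> b = 0 \<and> c = 0)"

lemma indep3_perm: "indep3 P Q R \<Longrightarrow> indep3 Q P R" "indep3 P Q R \<Longrightarrow> indep3 R Q P"
  unfolding indep3_def by (metis add.commute, metis add.commute add.left_commute)

text \<open>By \<open>ht_sum3\<close>, 9 ht S is at most 9 ht P minus the height of aP - bQ, which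
  is positive by independence. The new triple is independent because tripling a relation l S + m Q +
  n R = 0 gives P the coefficient l a.\<close>

lemma descent_step:
  assumes ind: "indep3 P Q R" and S: "sm a P + sm b Q + sm c R = S + S + S"
    and ran: "a \<in> {- 1, 1}" "b \<in> {- 1, 0, 1}" "c \<in> {- 1, 0, 1}"
    and le: "b \<noteq> 0 \<Longrightarrow> ht Q \<le> ht P" "c \<noteq> 0 \<Longrightarrow> ht R \<le> ht P"
  shows "ht S < ht P" "indep3 S Q R"
proof -
  have "sm a P - sm b Q \<noteq> 0"
  proof
    assume "sm a P - sm b Q = 0"
    moreover have "sm a P + sm (- b) Q + sm 0 R = sm a P - sm b Q"
      unfolding sm_uminus sm_0 add_0_right by (rule add_uminus_conv_diff)
    ultimately have "sm a P + sm (- b) Q + sm 0 R = 0" by metis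
    with ind have "a = 0" unfolding indep3_def by metis
    thus False using ran(1) by simp
  qed
  hence "ht (sm a P - sm b Q) > 0" using ht_eq_0_iff by (metis gr0I)
  moreover have "ht (sm a P) = ht P" "ht (sm b Q) \<le> ht P" "ht (sm c R) \<le> ht P"
    using ran le ht_sm_unit[of a P] ht_sm_unit[of b Q] ht_sm_unit[of c R] by auto
  moreover have "ht (S + S + S) = 9 * ht S" by (rule ht_triple)
  moreover have "s < p" if "t = 9 * s" "t + x + y + z = 3 * (p + q + r)" "0 < x" "q \<le> p" "r \<le> p"
    for s t x y z p q r :: nat using that unfolding distrib_left by linarith
  ultimately show "ht S < ht P"
    using ht_sum3[of "sm a P" "sm b Q" "sm c R"] unfolding S by metis
  show "indep3 S Q R"
    unfolding indep3_def
  proof (intro allI impI)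
    fix l m n assume "sm l S + sm m Q + sm n R = 0"
    hence "sm 3 (sm l S + sm m Q + sm n R) = 0" by simp
    hence "sm l (sm 3 S) + sm (3 * m) Q + sm (3 * n) R = 0"
      by (simp add: sm_add_right flip: sm_mult) (simp add: mult.commute)
    hence "sm l (sm a P + sm b Q + sm c R) + sm (3 * m) Q + sm (3 * n) R = 0"
      by (simp add: S sm_3)
    hence "sm (l * a) P + sm (l * b + 3 * m) Q + sm (l * c + 3 * n) R = 0"
      by (simp only: sm_add_right sm_add sm_mult add_ac)
    hence "l * a = 0" "l * b + 3 * m = 0" "l * c + 3 * n = 0"
      using ind unfolding indep3_def by blast+
    thus "l = 0 \<and> m = 0 \<and> n = 0" using ran(1) by auto
  qed
qed

lemma descent_contradiction:
  assumes "indep3 P Q R" "sm a P + sm b Q + sm c R = S + S + S"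
    and "a \<in> {- 1, 0, 1}" "b \<in> {- 1, 0, 1}" "c \<in> {- 1, 0, 1}" "a \<noteq> 0 \<or> b \<noteq> 0 \<or> c \<noteq> 0"
  shows "\<exists>P' Q' R'. indep3 P' Q' R' \<and> ht P' + ht Q' + ht R' < ht P + ht Q + ht R"
proof -
  have main: "\<exists>P' Q' R'. indep3 P' Q' R' \<and> ht P' + ht Q' + ht R' < ht P + ht Q + ht R"
    if "indep3 P Q R" "sm a P + sm b Q + sm c R = S + S + S" "a \<in> {- 1, 1}" "b \<in> {- 1, 0, 1}" "c \<in> {- 1, 0, 1}"
      "b \<noteq> 0 \<longrightarrow> ht Q \<le> ht P" "c \<noteq> 0 \<longrightarrow> ht R \<le> ht P" for P Q R a b c
    using descent_step[OF that(1-5)] that(6,7) by (intro exI[of _ S] exI[of _ Q] exI[of _ R]) auto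
  note perm = indep3_perm(1)[OF assms(1)] indep3_perm(2)[OF assms(1)]
  have swap: "sm b Q + sm a P + sm c R = S + S + S" "sm c R + sm b Q + sm a P = S + S + S"
    using assms(2) by (simp_all add: ac_simps)
  \<comment> \<open>The point to be replaced is the highest one among those with nonzero
    coefficient.\<close>
  consider "a \<noteq> 0" "b \<noteq> 0 \<longrightarrow> ht Q \<le> ht P" "c \<noteq> 0 \<longrightarrow> ht R \<le> ht P"
    | "b \<noteq> 0" "a \<noteq> 0 \<longrightarrow> ht P \<le> ht Q" "c \<noteq> 0 \<longrightarrow> ht R \<le> ht Q"
    | "c \<noteq> 0" "a \<noteq> 0 \<longrightarrow> ht P \<le> ht R" "b \<noteq> 0 \<longrightarrow> ht Q \<le> ht R"
    using assms(6) by linarith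
  thus ?thesis
  proof cases
    case 1
    thus ?thesis using main[OF assms(1,2)] assms(3-5) by simp
  next
    case 2
    thus ?thesis using main[OF perm(1) swap(1)] assms(3-5) by (simp add: ac_simps)
  next
    case 3
    thus ?thesis using main[OF perm(2) swap(2)] assms(3-5) by (simp add: ac_simps)
  qed
qed

text \<open>Pigeonhole: two of the 27 combinations with digits 0, 1, 2 have the same pair of
  \<open>rho\<close> values, so their difference is a triple. Multiples of 3 then bring its
  coefficients into the range -1, 0, 1.\<close>

lemma relation_mod_3:
  "\<exists>a b c S. a \<in> {- 1, 0, 1} \<and> b \<in> {- 1, 0, 1} \<and> c \<in> {- 1, 0, 1} \<and> (a \<noteq> 0 \<or> b \<noteq> 0 \<or> c \<noteq> 0)
    \<and> sm a P + sm b Q + sm c R = S + S + S"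
proof -
  define D :: "(int \<times> int \<times> int) set" where "D = {0, 1, 2} \<times> {0, 1, 2} \<times> {0, 1, 2}"
  define cmb where "cmb = (\<lambda>(i, j, l). sm i P + sm j Q + sm l R)"
  define f where "f v = (rho r1 (cmb v), rho r2 (cmb v))" for v
  \<comment> \<open>As the \<open>set\<close> of a list, its cardinality is bounded by the list
    length without comparing elements.\<close>
  define T where "T = set [1, om, om\<^sup>2]"
  have rs: "r1 \<in> kroots" "r2 \<in> kroots" by (auto simp: kroots_def)
  have "f ` D \<subseteq> T \<times> T"
    using eis_cube_root_1[OF rho_cube[OF rs(1)]] eis_cube_root_1[OF rho_cube[OF rs(2)]]
    by (auto simp: f_def T_def)
  moreover have "finite (T \<times> T)" by (simp add: T_def)
  ultimately have "card (f ` D) \<le> card T * card T"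
    by (metis card_mono card_cartesian_product)
  also have "card T \<le> 3" unfolding T_def using card_length[of "[1, om, om\<^sup>2]"] by simp
  hence "card T * card T \<le> 3 * 3" by (intro mult_le_mono)
  also have "\<dots> < card D" by (simp add: D_def card_cartesian_product)
  finally have "\<not> inj_on f D" by (rule pigeonhole)
  then obtain v v' where "v \<in> D" "v' \<in> D" "v \<noteq> v'" "f v = f v'" unfolding inj_on_def by blast
  then obtain i j l i' j' l' where v: "(i, j, l) \<in> D" "(i', j', l') \<in> D" "(i, j, l) \<noteq> (i', j', l')"
    "f (i, j, l) = f (i', j', l')" by (cases v; cases v') metis
  define X where "X = cmb (i, j, l) - cmb (i', j', l')"
  have one: "rho r X = 1" if "r \<in> kroots" "rho r (cmb (i, j, l)) = rho r (cmb (i', j', l'))" for r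
  proof -
    have "rho r (cmb (i', j', l')) \<noteq> 0" using rho_cube[OF that(1), of "cmb (i', j', l')"] by auto
    moreover have "X = cmb (i, j, l) + - cmb (i', j', l')" by (simp add: X_def)
    hence "rho r X = rho r (cmb (i, j, l)) * inverse (rho r (cmb (i', j', l')))"
      using rho_add[OF that(1)] rho_uminus[OF that(1)] by metis
    ultimately show ?thesis using that(2) by simp
  qed
  have "rho r1 X = 1" "rho r2 X = 1" using one v(4) rs by (auto simp: f_def)
  then obtain S where S: "X = S + S + S" using rho_1_imp_triple by blast
  have X: "X = sm (i - i') P + sm (j - j') Q + sm (l - l') R"
    by (simp add: X_def cmb_def sm_diff)
  \<comment> \<open>The clause on \<open>a = 0\<close> keeps the reduced relation nontrivial: a
    difference d in this range is divisible by 3 only if it is 0.\<close>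
  have red: "\<exists>a e. d = a + 3 * e \<and> a \<in> {- 1, 0, 1} \<and> (a = 0 \<longrightarrow> d = 0)"
    if "d \<in> {- 2, - 1, 0, 1, 2}" for d :: int
  proof -
    from that have "d = - 2 \<or> d = 2 \<or> d \<in> {- 1, 0, 1}" by simp metis
    then consider "d = - 2" | "d = 2" | "d \<in> {- 1, 0, 1}" by blast
    thus ?thesis
    proof cases
      case 1
      thus ?thesis by (intro exI[of _ 1] exI[of _ "- 1"]) simp
    next
      case 2
      thus ?thesis by (intro exI[of _ "- 1"] exI[of _ 1]) simp
    next
      case 3
      thus ?thesis by (intro exI[of _ d] exI[of _ 0]) simp
    qed
  qed
  have diff: "m - n \<in> {- 2, - 1, 0, 1, 2}" if "m \<in> {0, 1, 2}" "n \<in> {0, 1, 2}" for m n :: int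
    using that by auto
  have "i - i' \<in> {- 2, - 1, 0, 1, 2}" "j - j' \<in> {- 2, - 1, 0, 1, 2}" "l - l' \<in> {- 2, - 1, 0, 1, 2}"
    by (rule diff; use v(1,2) in \<open>unfold D_def mem_Times_iff fst_conv snd_conv, blast\<close>)+
  note d = red[OF this(1)] red[OF this(2)] red[OF this(3)]
  obtain a e where a: "i - i' = a + 3 * e" "a \<in> {- 1, 0, 1}" "a = 0 \<longrightarrow> i - i' = 0" using d(1) by blast
  obtain b g where b: "j - j' = b + 3 * g" "b \<in> {- 1, 0, 1}" "b = 0 \<longrightarrow> j - j' = 0" using d(2) by blast
  obtain c h where c: "l - l' = c + 3 * h" "c \<in> {- 1, 0, 1}" "c = 0 \<longrightarrow> l - l' = 0" using d(3) by blast
  define Y where "Y = S - sm e P - sm g Q - sm h R"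
  have "S + S + S = sm a P + sm (3 * e) P + (sm b Q + sm (3 * g) Q) + (sm c R + sm (3 * h) R)"
    using X unfolding S a(1) b(1) c(1) sm_add .
  hence "sm a P + sm b Q + sm c R = Y + Y + Y"
    by (simp add: Y_def sm_mult sm_3 sm_add_right algebra_simps)
  moreover have "a \<noteq> 0 \<or> b \<noteq> 0 \<or> c \<noteq> 0" using a(3) b(3) c(3) v(3) by auto
  ultimately show ?thesis using a(2) b(2) c(2) by blast
qed

lemma not_indep3: "\<not> indep3 P Q R"
proof (induction "ht P + ht Q + ht R" arbitrary: P Q R rule: less_induct)
  case less
  show ?case
  proof
    assume "indep3 P Q R"
    obtain a b c S where "a \<in> {- 1, 0, 1}" "b \<in> {- 1, 0, 1}" "c \<in> {- 1, 0, 1}"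
      "a \<noteq> 0 \<or> b \<noteq> 0 \<or> c \<noteq> 0" "sm a P + sm b Q + sm c R = S + S + S"
      using relation_mod_3[of P Q R] by blast
    from descent_contradiction[OF \<open>indep3 P Q R\<close> this(5,1-4)]
    obtain P' Q' R' where "indep3 P' Q' R'" "ht P' + ht Q' + ht R' < ht P + ht Q + ht R" by blast
    with less show False by blast
  qed
qed

section \<open>Transfer to lists of points\<close>

lemma foldr_cadd_Rep:
  "length cs = length Ps \<Longrightarrow>
    foldr (cadd kT) (map2 (csmul kT) cs (map Rep_pt Ps)) None = Rep_pt (sum_list (map2 sm cs Ps))"
  by (induction cs Ps rule: list_induct2) (simp_all add: Rep_zero Rep_add Rep_sm)

lemma cindep_iff:
  "cindep kT (map Rep_pt Ps) \<longleftrightarrow>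
    (\<forall>cs. length cs = length Ps \<longrightarrow> sum_list (map2 sm cs Ps) = 0 \<longrightarrow> (\<forall>c\<in>set cs. c = 0))"
proof -
  have "Rep_pt X = None \<longleftrightarrow> X = 0" for X by (metis Rep_pt_inject Rep_zero)
  thus ?thesis unfolding cindep_def by (auto simp: foldr_cadd_Rep Rep_pt')
qed

lemma cindep_length:
  assumes "cindep kT ps"
  shows "length ps \<le> 2"
proof (rule ccontr)
  assume n: "\<not> length ps \<le> 2"
  have "\<forall>p\<in>set ps. on_cubic kT p" using assms by (simp add: cindep_def)
  hence ps: "map Rep_pt (map Abs_pt ps) = ps" by (induction ps) (simp_all add: Abs_pt_inverse)
  from n have "Suc (Suc (Suc 0)) \<le> length (map Abs_pt ps)" by simp
  then obtain P Q R Ps where "map Abs_pt ps = P # Q # R # Ps"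
    unfolding Suc_le_length_iff by metis
  with assms ps have ind: "cindep kT (map Rep_pt (P # Q # R # Ps))" by metis
  have "indep3 P Q R"
    unfolding indep3_def
  proof (intro allI impI)
    fix a b c assume 0: "sm a P + sm b Q + sm c R = 0"
    have "sum_list (map2 sm (replicate (length Ps) 0) Ps) = 0" by (induction Ps) simp_all
    hence "sum_list (map2 sm (a # b # c # replicate (length Ps) 0) (P # Q # R # Ps)) = 0"
      using 0 by (simp add: ac_simps)
    hence "\<forall>c\<in>set (a # b # c # replicate (length Ps) 0). c = 0"
      using ind unfolding cindep_iff by (metis length_Cons length_replicate)
    thus "a = 0 \<and> b = 0 \<and> c = 0" by simp
  qed
  thus False using not_indep3 by blast
qed

section \<open>Two independent points\<close>

lemma rho_sm_mod:
  assumes "r \<in> kroots"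
  shows "rho r (sm n P) = rho r P ^ nat (n mod 3)"
proof -
  have "n = 3 * (n div 3) + n mod 3" by simp
  hence "sm n P = sm (3 * (n div 3)) P + sm (n mod 3) P" by (metis sm_add)
  also have "sm (3 * (n div 3)) P = sm (n div 3) P + sm (n div 3) P + sm (n div 3) P"
    by (simp add: sm_mult sm_3)
  finally have "rho r (sm n P) = rho r (sm (n div 3) P) ^ 3 * rho r (sm (n mod 3) P)"
    using assms by (simp add: rho_add power3_eq_cube)
  also have "\<dots> = rho r (sm (n mod 3) P)" using rho_cube[OF assms] by simp
  also have "\<dots> = rho r P ^ nat (n mod 3)"
  proof -
    have "rho r (((+) P ^^ m) 0) = rho r P ^ m" for m
      by (induction m) (simp_all add: rho_0 rho_add assms)
    thus ?thesis by (simp add: sm_def)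
  qed
  finally show ?thesis .
qed

lemma om_power_eq_1:
  assumes "om ^ nat (n mod 3) = 1"
  shows "3 dvd n"
proof -
  consider "n mod 3 = 0" | "n mod 3 = 1" | "n mod 3 = 2" by linarith
  thus ?thesis
    using assms by cases (auto simp: om2 eis_eq_iff)
qed

text \<open>\<open>rho r1\<close> forces 3 to divide b, which makes the contribution of V to
  \<open>rho r2\<close> trivial, so \<open>rho r2\<close> forces 3 to divide a. As there is no
  3-torsion, the relation can be divided by 3, and this cannot be repeated forever unless a = b =
  0.\<close>

lemma independent_pair:
  assumes rU: "rho r1 U = 1" "rho r2 U = om" and rV: "rho r1 V = om"
    and "sm a U + sm b V = 0"
  shows "a = 0 \<and> b = 0"
  using assms(4)
proof (induction "nat \<bar>a\<bar> + nat \<bar>b\<bar>" arbitrary: a b rule: less_induct)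
  case less
  have rs: "r1 \<in> kroots" "r2 \<in> kroots" by (auto simp: kroots_def)
  have "om ^ nat (b mod 3) = rho r1 (sm a U + sm b V)"
    using rs rU rV by (simp add: rho_add rho_sm_mod)
  also have "\<dots> = 1" using less.prems rs by (simp add: rho_0)
  finally have b: "3 dvd b" by (rule om_power_eq_1)
  hence "om ^ nat (a mod 3) = rho r2 (sm a U + sm b V)"
    using rs rU by (simp add: rho_add rho_sm_mod dvd_eq_mod_eq_0)
  also have "\<dots> = 1" using less.prems rs by (simp add: rho_0)
  finally have a: "3 dvd a" by (rule om_power_eq_1)
  obtain a' b' where ab: "a = 3 * a'" "b = 3 * b'" using a b by (auto elim!: dvdE)
  define X where "X = sm a' U + sm b' V"
  have "X + X + X = sm 3 (sm a' U) + sm 3 (sm b' V)" by (simp add: X_def sm_3 ac_simps)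
  also have "\<dots> = 0" using less.prems unfolding ab sm_mult .
  finally have X: "X = 0" by (simp only: triple_eq_0_iff)
  show ?case
  proof (cases "a = 0 \<and> b = 0")
    case False
    hence "nat \<bar>a'\<bar> + nat \<bar>b'\<bar> < nat \<bar>a\<bar> + nat \<bar>b\<bar>" using ab by auto
    from less.hyps[OF this X[unfolded X_def]] show ?thesis using ab by simp
  qed simp
qed

lemma exists_independent_pair: "\<exists>ps. length ps = 2 \<and> cindep kT ps"
proof -
  \<comment> \<open>With u = T^2 - T, k = 63 (3u + 1) (u^2 + 3). For x = 5u - 3 and y = 4u + 6 one
    has x + y = 3 (3u + 1) and x^2 - x y + y^2 = 21 (u^2 + 3).\<close>
  have "[:-3, -5, 5:] ^ 3 + [:6, -4, 4:] ^ 3 = kp * 1 ^ 3"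
    by (simp add: kp_def Q_defs power3_eq_cube)
  then obtain U where U: "hc U [:-3, -5, 5:] [:6, -4, 4:] 1" by (rule hc_ex) simp
  \<comment> \<open>T -> 1/T reverses coefficient lists: it exchanges \<open>Q1\<close> and
    \<open>Q3\<close>, fixes \<open>Q2\<close>, and returns k up to T^6, the cube of the factor T^2
    that clears the denominators of the coordinates.\<close>
  have "[:5, -5, -3:] ^ 3 + [:4, -4, 6:] ^ 3 = kp * 1 ^ 3"
    by (simp add: kp_def Q_defs power3_eq_cube)
  then obtain V where V: "hc V [:5, -5, -3:] [:4, -4, 6:] 1" by (rule hc_ex) simp
  have rho: "rho r P = v" if "hc P x y 1" "poly (rp y) r \<noteq> 0" "- poly (rp x) r = v * poly (rp y) r" for r P v x y
    using rho_eq[OF that(1,2)] that(2,3) by (simp add: nonzero_divide_eq_eq)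
  have "rho r1 U = 1" by (rule rho[OF U]) (simp_all add: eis_eq_iff)
  moreover have "rho r2 U = om" by (rule rho[OF U]) (simp_all add: eis_eq_iff)
  moreover have "rho r1 V = om" by (rule rho[OF V]) (simp_all add: eis_eq_iff)
  ultimately have ind: "a = 0 \<and> b = 0" if "sm a U + sm b V = 0" for a b
    using independent_pair that by blast
  have "cindep kT (map Rep_pt [U, V])"
    unfolding cindep_iff using ind by (auto simp: length_Suc_conv numeral_2_eq_2)
  thus ?thesis by (intro exI[of _ "map Rep_pt [U, V]"]) simp
qed

theorem theorem1p1:
  shows "mw_rank_eq kT 2"
  unfolding mw_rank_eq_def using exists_independent_pair cindep_length by blast

end
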